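(* Let $\theta$ be the random density sampled by a Pólya tree $PT(\mathcal B,\mathcal A)$ on a compact set $\mathcal X\subset\mathbb R^d$ ($d\ge1$) such that $\alpha_\epsilon=a_{l(\epsilon)}$ depends only on the length of $\epsilon$, $\sum_{l\ge1} l/a_l<\infty$, and $\lambda(B_\epsilon)=2^{-l(\epsilon)}$ for all $\epsilon\in E$. Let $f_0$ be a probability density on $\mathcal X$ with $|H(f_0)|<\infty$, where $H(f_0)=-\int_{\mathcal X} f_0(t)\log f_0(t)\,dt$, and with $$\sup_{\epsilon=(\epsilon_1\dots\epsilon_k)\in E,\ k\ge1}\frac{P_{f_0}(B_{\epsilon_1\dots\epsilon_k})}{P_{f_0}(B_{\epsilon_1\dots\epsilon_{k-1}})}<1 .$$ Let $X_1,X_2,\dots$ be i.i.d. with density $f_0$, $\mathbf X_n=(X_1,\dots,X_n)$, and let $$\hat H(\mathbf X_n)=-\mathbb E\left[\frac1n\sum_{i=1}^n\log\theta(X_i)\,\Big|\,\mathbf X_n\right]=-\sum_{\epsilon\in E,\ l(\epsilon)\ge1}\frac{N_\epsilon}{n}\,\mathbb E[\log(2Y_\epsilon)\mid\mathbf X_n].$$ If $a_l=2^{\beta l}$ for some $\beta>2$, then $|\hat H(\mathbf X_n)-H(f_0)|\to0$ in probability as $n\to\infty$.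
   Context: $E$ is the set of all finite binary sequences, including the empty sequence $\emptyset$; $l(\epsilon)$ is the length of $\epsilon$; $\lambda$ is Lebesgue measure; $P_{f_0}(B)=\int_B f_0\,d\lambda$. $\mathcal B=\{B_\epsilon:\epsilon\in E\}$ is a family of Borel subsets of $\mathcal X$ with $B_\emptyset=\mathcal X$, $\{B_{\epsilon0},B_{\epsilon1}\}$ a partition of $B_\epsilon$ for every $\epsilon\in E$, and $\mathcal B$ generating the Borel $\sigma$-algebra of $\mathcal X$. $\mathcal A=\{\alpha_\epsilon:\epsilon\in E\}$ is a family of positive reals. A Pólya tree $PT(\mathcal B,\mathcal A)$ is the law of a random probability measure $\mathcal P$ on $\mathcal X$ such that the variables $\mathcal P(B_{\epsilon0}\mid B_\epsilon)$, $\epsilon\in E$, are independent with $\mathcal P(B_{\epsilon0}\mid B_\epsilon)\sim\mathrm{Beta}(\alpha_{\epsilon0},\alpha_{\epsilon1})$. For $\epsilon=(\epsilon_1\dots\epsilon_k)$, $k\ge1$, $Y_\epsilon:=\mathcal P(B_{\epsilon_1\dots\epsilon_k}\mid B_{\epsilon_1\dots\epsilon_{k-1}})$. Under the assumptions of the statement $\mathcal P$ is a.s. absolutely continuous with respect to $\lambda$ and $\theta$ denotes its density; $\theta(x)=\prod_{j\ge1}2Y_{\epsilon_1(x)\dots\epsilon_j(x)}$ where $\epsilon_1(x)\epsilon_2(x)\dots$ is the sequence with $x\in B_{\epsilon_1(x)\dots\epsilon_j(x)}$ for all $j$. Given $\mathbf X_n$, the posterior is the Pólya tree $PT(\mathcal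 B,\{\alpha_\epsilon+N_\epsilon:\epsilon\in E\})$ with $N_\epsilon=\sum_{i=1}^n I_{B_\epsilon}(X_i)$; $\mathbb E[\cdot\mid\mathbf X_n]$ denotes expectation (over $\theta$, equivalently the $Y_\epsilon$) under this posterior, with $X_1,\dots,X_n$ fixed. *)

theory Defs
  imports "HOL-Probability.Probability"
begin

text \<open>A finite binary sequence is a \<open>bool list\<close>, read from left to right, with \<open>False\<close> and
  \<open>True\<close> for the digits 0 and 1. Appending a digit is \<open>\<epsilon> @ [b]\<close>; dropping the last
  digit is \<open>butlast\<close>.\<close>

definition partition_tree :: "'a::topological_space set \<Rightarrow> (bool list \<Rightarrow> 'a set) \<Rightarrow> bool" where
  "partition_tree \<X> B \<longleftrightarrow>
     (\<forall>\<epsilon>. B \<epsilon> \<in> sets borel) \<and>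
     B [] = \<X> \<and>
     (\<forall>\<epsilon>. B (\<epsilon> @ [False]) \<union> B (\<epsilon> @ [True]) = B \<epsilon> \<and>
          B (\<epsilon> @ [False]) \<inter> B (\<epsilon> @ [True]) = {}) \<and>
     sets (restrict_space borel \<X>) = sigma_sets \<X> (range B)"

definition beta_density :: "real \<Rightarrow> real \<Rightarrow> real \<Rightarrow> real" where
  "beta_density p q y =
     (if 0 < y \<and> y < 1 then y powr (p - 1) * (1 - y) powr (q - 1) / Beta p q else 0)"

definition Y :: "(bool list \<Rightarrow> 'a set) \<Rightarrow> 'a measure \<Rightarrow> bool list \<Rightarrow> real" where
  "Y B P \<epsilon> = \<P>(x in P. x \<in> B \<epsilon> \<bar> x \<in> B (butlast \<epsilon>))"

text \<open>\<open>polya_tree \<X> B \<alpha> L\<close>: the measure \<open>L\<close>, living on the space of probability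
  measures on \<open>\<X>\<close>, is the law of a Polya tree with parameters \<open>\<alpha>\<close>.\<close>

definition polya_tree ::
  "'a::topological_space set \<Rightarrow> (bool list \<Rightarrow> 'a set) \<Rightarrow> (bool list \<Rightarrow> real) \<Rightarrow> 'a measure measure \<Rightarrow> bool"
where
  "polya_tree \<X> B \<alpha> L \<longleftrightarrow>
     prob_space L \<and>
     sets L = sets (prob_algebra (restrict_space borel \<X>)) \<and>
     prob_space.indep_vars L (\<lambda>_. borel) (\<lambda>\<epsilon> P. Y B P (\<epsilon> @ [False])) UNIV \<and>
     (\<forall>\<epsilon>. distributed L lborel (\<lambda>P. Y B P (\<epsilon> @ [False]))
            (\<lambda>y. ennreal (beta_density (\<alpha> (\<epsilon> @ [False])) (\<alpha> (\<epsilon> @ [True])) y)))"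

definition sample_count :: "(bool list \<Rightarrow> 'a set) \<Rightarrow> nat \<Rightarrow> (nat \<Rightarrow> 'a) \<Rightarrow> bool list \<Rightarrow> real" where
  "sample_count B n x \<epsilon> = (\<Sum>i<n. indicator (B \<epsilon>) (x i))"

definition posterior_param ::
  "(bool list \<Rightarrow> 'a set) \<Rightarrow> (bool list \<Rightarrow> real) \<Rightarrow> nat \<Rightarrow> (nat \<Rightarrow> 'a) \<Rightarrow> bool list \<Rightarrow> real" where
  "posterior_param B \<alpha> n x \<epsilon> = \<alpha> \<epsilon> + sample_count B n x \<epsilon>"

definition digits :: "(bool list \<Rightarrow> 'a set) \<Rightarrow> 'a \<Rightarrow> nat \<Rightarrow> bool list" where
  "digits B x j = (THE \<epsilon>. length \<epsilon> = j \<and> x \<in> B \<epsilon>)"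

text \<open>The density of the random measure \<open>P\<close>, in the version given by the infinite product of
  the \<open>2 Y\<close>. It is the limit of the partial products rather than \<^const>\<open>prodinf\<close>, because
  the latter does not count a product whose partial products tend to 0 as convergent.\<close>

definition tree_density :: "(bool list \<Rightarrow> 'a set) \<Rightarrow> 'a measure \<Rightarrow> 'a \<Rightarrow> real" where
  "tree_density B P x = lim (\<lambda>k. \<Prod>j=1..k. 2 * Y B P (digits B x j))"

text \<open>\<open>L\<close> is the posterior law given the sample \<open>x 0, \<dots>, x (n - 1)\<close>.\<close>

definition entropy_estimator ::
  "(bool list \<Rightarrow> 'a set) \<Rightarrow> 'a measure measure \<Rightarrow> nat \<Rightarrow> (nat \<Rightarrow> 'a) \<Rightarrow> real" where
  "entropy_estimator B L n x =
     - (LINT P|L. 1 / real n * (\<Sum>i<n. ln (tree_density B P (x i))))"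

definition prob_density_on :: "'a::euclidean_space set \<Rightarrow> ('a \<Rightarrow> real) \<Rightarrow> bool" where
  "prob_density_on \<X> f \<longleftrightarrow>
     (\<forall>x\<in>\<X>. 0 \<le> f x) \<and> set_integrable lborel \<X> f \<and> (LINT t:\<X>|lborel. f t) = 1"

text \<open>Since \<open>ln 0 = 0\<close>, the integrands below follow the convention \<open>0 log 0 = 0\<close>.\<close>

definition finite_entropy :: "'a::euclidean_space set \<Rightarrow> ('a \<Rightarrow> real) \<Rightarrow> bool" where
  "finite_entropy \<X> f \<longleftrightarrow> set_integrable lborel \<X> (\<lambda>t. f t * ln (f t))"

definition diff_entropy :: "'a::euclidean_space set \<Rightarrow> ('a \<Rightarrow> real) \<Rightarrow> real" where
  "diff_entropy \<X> f = - (LINT t:\<X>|lborel. f t * ln (f t))"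

definition converges_in_prob :: "'w measure \<Rightarrow> (nat \<Rightarrow> 'w \<Rightarrow> real) \<Rightarrow> real \<Rightarrow> bool" where
  "converges_in_prob M Z c \<longleftrightarrow>
     (\<forall>n. Z n \<in> borel_measurable M) \<and>
     (\<forall>\<delta>>0. (\<lambda>n. \<P>(\<omega> in M. \<delta> < \<bar>Z n \<omega> - c\<bar>)) \<longlonglongrightarrow> 0)"

end

theory Submission
  imports Defs "HOL-Real_Asymp.Real_Asymp"
begin

text \<open>The estimator depends on the posterior only through the marginal laws of the splitting
  variables, and for \<open>Y\<close> with a Beta law with parameters \<open>p\<close>, \<open>q\<close> the mean of \<open>ln (2 * Y)\<close> is
  \<open>ln (2 * p / (p + q))\<close> up to an error of \<open>2 / p\<close>. Hence minus the estimator is a sum of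
  contributions of the cells. As \<open>n\<close> grows, the contribution of a fixed cell converges in mean, by
  the law of large numbers, to the contribution of that cell to the integral of \<open>f0 * ln f0\<close>.
  The convergence is dominated: the expected contribution exceeds its limit by at most \<open>2 / n\<close>
  (Gibbs' inequality and the variance of the counts), and it is at most \<open>n / (2 * a l)\<close> because the
  prior shrinks all splits towards \<open>1 / 2\<close>; one of these two bounds is at most \<open>1 / sqrt (a l)\<close>.
  As there are fewer than \<open>2 ^ l\<close> such cells on level \<open>l\<close>, this is summable precisely because
  \<open>\<beta> > 2\<close>, and Tannery's theorem applies.
  Finally, the limits up to level \<open>k\<close> add up to the integral of \<open>g * ln g\<close>, where \<open>g\<close> averages \<open>f0\<close>
  over the cells of level \<open>k\<close>. It is at most the integral of \<open>f0 * ln f0\<close>, and since the averages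
  converge in mean to \<open>f0\<close>, Fatou's lemma yields equality in the limit.\<close>

section \<open>Logarithmic moments of the Beta distribution\<close>

text \<open>The obstacle is the exchange of the limit in n with the sum over infinitely many levels.
  The law of large numbers works cell by cell without uniformity: for every n, deep enough cells
  have expected counts far below 1, so the empirical frequencies there say nothing and only the
  prior keeps the estimate in place. Gibbs' inequality is used with the true masses as reference
  because it replaces logarithms of random frequencies by second moments of counts. A half-cell of
  mass p has a count N with E[N^2] / (n p) at most 1 + n p; the terms of order n cancel against the
  linear ones, and the excess 1 from each of the two halves is the 2 in 2 / n. The bounds 2 / n and
  n / (2 * a l) cross at n = 2 * sqrt (a l), which is where 1 / sqrt (a l) comes from. Siblings are
  kept together: their joint contribution is nonnegative up to the Beta error, so an upper bound on
  its mean also bounds its mean absolute value. That error is recorded twice, as 2 / a l for the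
  domination and as 4 / n for the limit at a fixed cell.\<close>

lemma beta_density_nonneg: "0 < p \<Longrightarrow> 0 < q \<Longrightarrow> 0 \<le> beta_density p q y"
  by (auto simp: beta_density_def Beta_def intro!: mult_nonneg_nonneg divide_nonneg_nonneg Gamma_real_nonneg)

lemma borel_measurable_beta_density [measurable]: "beta_density p q \<in> borel_measurable borel"
  unfolding beta_density_def by measurable

lemma beta_density_reflect: "beta_density p q (1 - y) = beta_density q p y"
  by (auto simp: beta_density_def Beta_commute)

lemma Beta_pos: "0 < p \<Longrightarrow> 0 < q \<Longrightarrow> 0 < Beta p (q::real)"
  by (auto simp: Beta_def intro!: divide_pos_pos mult_pos_pos Gamma_real_pos)

lemma has_bochner_integral_beta_density:
  assumes "0 < p" "0 < q"
  shows "has_bochner_integral lborel (beta_density p q) 1"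
proof (rule has_bochner_integral_nn_integral)
  have B: "0 < Beta p q" using assms by (rule Beta_pos)
  have "((\<lambda>y. y powr (p - 1) * (1 - y) powr (q - 1)) has_integral Beta p q) {0<..<1}"
    using has_integral_Beta_real[OF assms] by (simp add: has_integral_Icc_iff_Ioo)
  then have "((\<lambda>y. if y \<in> {0<..<1} then y powr (p - 1) * (1 - y) powr (q - 1) else 0) has_integral Beta p q) UNIV"
    by (simp only: has_integral_restrict_UNIV)
  then have "((\<lambda>y. (if y \<in> {0<..<1} then y powr (p - 1) * (1 - y) powr (q - 1) else 0) * (1 / Beta p q)) has_integral Beta p q * (1 / Beta p q)) UNIV"
    by (rule has_integral_mult_left)
  moreover have "beta_density p q = (\<lambda>y. (if y \<in> {0<..<1} then y powr (p - 1) * (1 - y) powr (q - 1) else 0) * (1 / Beta p q))"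
    by (auto simp: beta_density_def fun_eq_iff)
  ultimately have "(beta_density p q has_integral 1) UNIV"
    using B by simp
  then show "(\<integral>\<^sup>+ x. ennreal (beta_density p q x) \<partial>lborel) = ennreal 1"
    by (intro nn_integral_has_integral_lborel) (auto simp: beta_density_nonneg assms)
qed (use assms in \<open>auto simp: beta_density_nonneg\<close>)

text \<open>Multiplying the density by y raises its first parameter by one, so the mean is the
  quotient of two values of the Beta function.\<close>

lemma has_bochner_integral_beta_mean:
  assumes "0 < p" "0 < q"
  shows "has_bochner_integral lborel (\<lambda>y. beta_density p q y * y) (p / (p + q))"
proof -
  have "(p + q) * Beta (p + 1) q = p * Beta p q"
    using assms by (intro Beta_plus1_left) (auto elim!: nonpos_Ints_cases)
  then have r: "Beta (p + 1) q / Beta p q = p / (p + q)"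
    using assms Beta_pos[OF assms] by (simp add: field_simps)
  have "beta_density p q y * y = p / (p + q) * beta_density (p + 1) q y" for y
  proof (cases "0 < y \<and> y < 1")
    case True
    have "y powr p = y powr (p - 1) * y"
      using True powr_add[of y "p - 1" 1] by simp
    with True show ?thesis
      using Beta_pos[OF assms] Beta_pos[of "p + 1" q] assms
      by (simp add: beta_density_def r[symmetric])
  qed (auto simp: beta_density_def)
  with has_bochner_integral_mult_right[OF has_bochner_integral_beta_density[of "p + 1" q], of "p / (p + q)"]
  show ?thesis using assms by simp
qed

text \<open>Dividing the density by y lowers its first parameter by one, which must stay positive;
  hence \<open>1 < p\<close>.\<close>

lemma has_bochner_integral_beta_inverse_mean:
  assumes "1 < p" "0 < q"
  shows "has_bochner_integral lborel (\<lambda>y. beta_density p q y * (1 / y)) ((p + q - 1) / (p - 1))"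
proof -
  have "(p - 1 + q) * Beta (p - 1 + 1) q = (p - 1) * Beta (p - 1) q"
    using assms by (intro Beta_plus1_left) (auto elim!: nonpos_Ints_cases)
  then have r: "Beta (p - 1) q / Beta p q = (p + q - 1) / (p - 1)"
    using assms Beta_pos[of p q] by (simp add: field_simps)
  have "beta_density p q y * (1 / y) = (p + q - 1) / (p - 1) * beta_density (p - 1) q y" for y
  proof (cases "0 < y \<and> y < 1")
    case True
    have "y powr (p - 1) = y powr (p - 1 - 1) * y"
      using True powr_add[of y "p - 1 - 1" 1] by simp
    with True show ?thesis
      using Beta_pos[of p q] Beta_pos[of "p - 1" q] assms
      by (simp add: beta_density_def r[symmetric])
  qed (auto simp: beta_density_def)
  with has_bochner_integral_mult_right[OF has_bochner_integral_beta_density[of "p - 1" q], of "(p + q - 1) / (p - 1)"]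
  show ?thesis using assms by simp
qed

text \<open>Scaling the square by a free parameter \<open>s\<close> lets the first moments of \<open>z\<close> and \<open>1 / z\<close>
  control the absolute moment of \<open>ln z\<close> near \<open>z = 1\<close>.\<close>

lemma abs_ln_le_scaled:
  assumes "0 < z" "0 < (s::real)"
  shows "\<bar>ln z\<bar> \<le> (s * (z - 2 + 1 / z) + 1 / s) / 2"
proof -
  have sq: "(ln z)\<^sup>2 \<le> z - 2 + 1 / z"
  proof -
    \<comment> \<open>The claim is |t| \<le> 2 sinh(|t| / 2) for t = ln z, squared. In terms of w =
      sqrt z the right side becomes |w - 1 / w|.\<close>
    define w where "w = sqrt z"
    have w: "0 < w" "z = w\<^sup>2" using assms by (auto simp: w_def)
    have "ln z = 2 * ln w" using w by (simp add: ln_realpow)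
    moreover have "\<bar>2 * ln v\<bar> \<le> \<bar>v - 1 / v\<bar>" if v: "0 < v" for v :: real
    proof -
      have key: "2 * ln v \<le> v - 1 / v" if v: "1 \<le> v" for v :: real
      proof -
        have "(v - 1 / v) - 2 * ln v \<ge> (1 - 1 / 1) - 2 * ln (1::real)"
        proof (rule DERIV_nonneg_imp_nondecreasing[OF v])
          fix x :: real assume x: "1 \<le> x" "x \<le> v"
          have "((\<lambda>x. (x - 1 / x) - 2 * ln x) has_real_derivative (1 - 1 / x)\<^sup>2) (at x)"
            using x by (auto intro!: derivative_eq_intros simp: field_simps power2_eq_square)
          then show "\<exists>y. ((\<lambda>x. (x - 1 / x) - 2 * ln x) has_real_derivative y) (at x) \<and> 0 \<le> y"
            by auto
        qed
        then show ?thesis by simp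
      qed
      show ?thesis
      proof (cases "1 \<le> v")
        case True
        then have "1 / v \<le> v" "0 \<le> ln v"  by (auto simp: divide_le_eq intro: order_trans[of 1 v "v * v"] mult_right_mono[of 1 v v, simplified])
        with key[OF True] show ?thesis by simp
      next
        case False
        have "1 \<le> 1 / v" using False v by simp
        from key[OF this] have "- 2 * ln v \<le> 1 / v - v" using v by (simp add: ln_div)
        moreover have "ln v \<le> 0" using False v by simp
        ultimately show ?thesis by simp
      qed
    qed
    ultimately have "\<bar>ln z\<bar> \<le> \<bar>w - 1 / w\<bar>" using w by simp
    then have "(ln z)\<^sup>2 \<le> (w - 1 / w)\<^sup>2" by (simp add: abs_le_square_iff)
    also have "\<dots> = z - 2 + 1 / z" using w by (simp add: field_simps power2_eq_square)
    finally show ?thesis .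
  qed
  \<comment> \<open>Weighted arithmetic-geometric mean inequality, by completing the square.\<close>
  have "0 \<le> (sqrt s * \<bar>ln z\<bar> - 1 / sqrt s)\<^sup>2" by simp
  also have "\<dots> = s * (ln z)\<^sup>2 + 1 / s - 2 * \<bar>ln z\<bar>"
    using assms by (simp add: power2_diff power_mult_distrib power_divide)
  finally have "2 * \<bar>ln z\<bar> \<le> s * (ln z)\<^sup>2 + 1 / s" by simp
  also have "\<dots> \<le> s * (z - 2 + 1 / z) + 1 / s" using sq assms by simp
  finally show ?thesis by simp
qed

text \<open>This is \<open>abs_ln_le_scaled\<close> at z = 2 y, integrated against the Beta density:
  the right side contains the means of 2 y and of 1 / (2 y). The parameter \<open>s\<close> stays
  free so that it can be matched to the concentration of the law.\<close>

lemma beta_abs_ln_bound: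
  assumes "1 < p" "0 < q" "0 < s"
  shows "integrable lborel (\<lambda>y. beta_density p q y * ln (2 * y))" (is ?int)
    and "(LINT y|lborel. \<bar>beta_density p q y * ln (2 * y)\<bar>)
          \<le> (s * (2 * p / (p + q) - 2 + (p + q - 1) / (2 * (p - 1))) + 1 / s) / 2" (is ?le)
proof -
  have p: "0 < p" using assms by simp
  define h where "h y = (s / 2) * (2 * (beta_density p q y * y) - 2 * beta_density p q y
     + (1/2) * (beta_density p q y * (1 / y))) + (1 / s) / 2 * beta_density p q y" for y
  have h: "has_bochner_integral lborel h ((s * (2 * p / (p + q) - 2 + (p + q - 1) / (2 * (p - 1))) + 1 / s) / 2)"
  proof -
    have "has_bochner_integral lborel h ((s / 2) * (2 * (p / (p + q)) - 2 * 1
       + (1/2) * ((p + q - 1) / (p - 1))) + (1 / s) / 2 * 1)"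
      unfolding h_def
      by (intro has_bochner_integral_add has_bochner_integral_diff has_bochner_integral_mult_right
          has_bochner_integral_beta_density has_bochner_integral_beta_mean has_bochner_integral_beta_inverse_mean)
        (use assms p in auto)
    also have "(s / 2) * (2 * (p / (p + q)) - 2 * 1 + (1/2) * ((p + q - 1) / (p - 1))) + (1 / s) / 2 * 1
      = (s * (2 * p / (p + q) - 2 + (p + q - 1) / (2 * (p - 1))) + 1 / s) / 2"
      by (simp add: add_divide_distrib)
    finally show ?thesis .
  qed
  have le: "\<bar>beta_density p q y * ln (2 * y)\<bar> \<le> h y" for y
  proof (cases "0 < y \<and> y < 1")
    case True
    have "\<bar>ln (2 * y)\<bar> \<le> (s * (2 * y - 2 + 1 / (2 * y)) + 1 / s) / 2"
      using True assms by (intro abs_ln_le_scaled) auto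
    from mult_left_mono[OF this beta_density_nonneg[OF p assms(2), of y]]
    show ?thesis
      using beta_density_nonneg[OF p assms(2), of y]
      by (simp add: h_def abs_mult algebra_simps add_divide_distrib diff_divide_distrib)
  qed (auto simp: beta_density_def h_def)
  show ?int
    by (rule Bochner_Integration.integrable_bound[OF has_bochner_integral_iff[THEN iffD1, THEN conjunct1, OF h]])
       (use order_trans[OF le abs_ge_self] in auto)
  then show ?le
    unfolding has_bochner_integral_integral_eq[OF h, symmetric]
    by (intro integral_mono integrable_abs has_bochner_integral_iff[THEN iffD1, THEN conjunct1, OF h] le)
qed

text \<open>For positive parameters this is ln 2 + psi(p) - psi(p + q) with the digamma function
  psi.\<close>

definition beta_log_mean :: "real \<Rightarrow> real \<Rightarrow> real" where
  "beta_log_mean p q = (LINT y|lborel. beta_density p q y * ln (2 * y))"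

text \<open>Jensen's inequality, via the tangent of the logarithm at the mean m: ln y \<le> ln m + y
  / m - 1.\<close>

lemma beta_log_mean_upper:
  assumes "1 < p" "0 < q"
  shows "beta_log_mean p q \<le> ln (2 * p / (p + q))"
proof -
  define m where "m = p / (p + q)"
  have m: "0 < m" using assms by (simp add: m_def)
  have "has_bochner_integral lborel (\<lambda>y. ln (2 * m) * beta_density p q y + (1 / m * (beta_density p q y * y) - beta_density p q y))
     (ln (2 * m) * 1 + (1 / m * (p / (p + q)) - 1))" (is "has_bochner_integral _ ?h _")
    by (intro has_bochner_integral_add has_bochner_integral_diff has_bochner_integral_mult_right
          has_bochner_integral_beta_density has_bochner_integral_beta_mean)
        (use assms in auto)
  moreover have "beta_density p q y * ln (2 * y) \<le> ?h y" for y
  proof (cases "0 < y \<and> y < 1")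
    case True
    have "ln (2 * y) - ln (2 * m) = ln (y / m)" using True m by (simp add: ln_div ln_mult)
    also have "\<dots> \<le> y / m - 1" using True m by (intro ln_le_minus_one) auto
    finally have "ln (2 * y) \<le> ln (2 * m) + (1 / m * y - 1)" by simp
    from mult_left_mono[OF this beta_density_nonneg[of p q y]]
    show ?thesis using assms by (simp add: algebra_simps)
  qed (auto simp: beta_density_def)
  ultimately have "beta_log_mean p q \<le> ln (2 * m) * 1 + (1 / m * (p / (p + q)) - 1)"
    unfolding beta_log_mean_def
    by (metis (no_types, lifting) has_bochner_integral_iff integral_mono beta_abs_ln_bound(1)[OF assms zero_less_one])
  then show ?thesis using assms by (simp add: m_def)
qed

text \<open>The reverse tangent bound ln y \<ge> ln m + 1 - m / y brings in the inverse moment. The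
  loss is q / ((p + q) (p - 1)), at most 1 / (p - 1), and this is at most 2 / p once
  \<open>2 \<le> p\<close>.\<close>

lemma beta_log_mean_lower:
  assumes "2 \<le> p" "0 < q"
  shows "ln (2 * p / (p + q)) - 2 / p \<le> beta_log_mean p q"
proof -
  define m where "m = p / (p + q)"
  have m: "0 < m" using assms by (simp add: m_def)
  have "has_bochner_integral lborel (\<lambda>y. ln (2 * m) * beta_density p q y + (beta_density p q y - m * (beta_density p q y * (1 / y))))
     (ln (2 * m) * 1 + (1 - m * ((p + q - 1) / (p - 1))))" (is "has_bochner_integral _ ?h _")
    by (intro has_bochner_integral_add has_bochner_integral_diff has_bochner_integral_mult_right
          has_bochner_integral_beta_density has_bochner_integral_beta_inverse_mean)
        (use assms in auto)
  moreover have "?h y \<le> beta_density p q y * ln (2 * y)" for y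
  proof (cases "0 < y \<and> y < 1")
    case True
    have "ln (2 * m) - ln (2 * y) = ln (m / y)" using True m by (simp add: ln_div ln_mult)
    also have "\<dots> \<le> m / y - 1" using True m by (intro ln_le_minus_one) auto
    finally have "ln (2 * m) + (1 - m * (1 / y)) \<le> ln (2 * y)" by simp
    from mult_left_mono[OF this beta_density_nonneg[of p q y]]
    show ?thesis using assms by (simp add: algebra_simps)
  qed (auto simp: beta_density_def)
  ultimately have "ln (2 * m) * 1 + (1 - m * ((p + q - 1) / (p - 1))) \<le> beta_log_mean p q"
    unfolding beta_log_mean_def
    by (metis (no_types, lifting) has_bochner_integral_iff integral_mono beta_abs_ln_bound(1)[OF _ assms(2) zero_less_one]
         assms(1) less_le_trans one_less_numeral_iff semiring_norm(76))
  moreover have "1 - m * ((p + q - 1) / (p - 1)) \<ge> - (2 / p)"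
  proof -
    have "m * ((p + q - 1) / (p - 1)) = 1 + q / ((p + q) * (p - 1))"
      using assms unfolding m_def by (simp add: divide_simps) (simp add: algebra_simps)
    moreover have "q / ((p + q) * (p - 1)) \<le> 1 / (p - 1)"
      using assms by (simp add: divide_simps)
    moreover have "1 / (p - 1) \<le> 2 / p" using assms by (simp add: divide_simps)
    ultimately show ?thesis by linarith
  qed
  ultimately show ?thesis by (simp add: m_def)
qed

section \<open>Cells and digits\<close>

abbreviation words :: "nat \<Rightarrow> bool list set" where
  "words k \<equiv> {\<epsilon>. length \<epsilon> = k}"

lemma finite_words [simp]: "finite (words k)"
  using finite_lists_length_eq[of "UNIV :: bool set" k] by simp

lemma card_words: "card (words k) = 2 ^ k"
  using card_lists_length_eq[of "UNIV :: bool set" k] by simp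

lemma words_0: "words 0 = {[]}"
  by auto

lemma sum_words_Suc:
  "(\<Sum>\<epsilon>\<in>words (Suc k). g \<epsilon>) = (\<Sum>\<sigma>\<in>words k. g (\<sigma> @ [False]) + g (\<sigma> @ [True]))" for g :: "bool list \<Rightarrow> real"
proof -
  have "(\<Sum>\<epsilon>\<in>words (Suc k). g \<epsilon>) = (\<Sum>(\<sigma>, b)\<in>words k \<times> UNIV. g (\<sigma> @ [b]))"
    by (rule sum.reindex_bij_witness[where i="\<lambda>(\<sigma>, b). \<sigma> @ [b]" and j="\<lambda>\<epsilon>. (butlast \<epsilon>, last \<epsilon>)"])
      (auto simp: length_Suc_conv_rev)
  also have "\<dots> = (\<Sum>\<sigma>\<in>words k. \<Sum>b\<in>UNIV. g (\<sigma> @ [b]))"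
    by (simp add: sum.cartesian_product)
  finally show ?thesis by (simp add: UNIV_bool add.commute)
qed

locale cell_tree =
  fixes \<X> :: "'a::topological_space set" and B :: "bool list \<Rightarrow> 'a set"
  assumes tree: "partition_tree \<X> B"
begin

lemma cell_sets [measurable]: "B \<epsilon> \<in> sets borel"
  using tree by (simp add: partition_tree_def)

lemma cell_Nil [simp]: "B [] = \<X>"
  using tree by (simp add: partition_tree_def)

lemma space_sets [measurable]: "\<X> \<in> sets borel"
  using cell_sets[of "[]"] by simp

lemma cell_children: "B (\<epsilon> @ [False]) \<union> B (\<epsilon> @ [True]) = B \<epsilon>"
  "B (\<epsilon> @ [False]) \<inter> B (\<epsilon> @ [True]) = {}"
  using tree by (auto simp: partition_tree_def)

lemma cell_child_iff: "x \<in> B (\<epsilon> @ [b]) \<longleftrightarrow> x \<in> B \<epsilon> \<and> x \<notin> B (\<epsilon> @ [\<not> b])"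
  using cell_children[of \<epsilon>] by (cases b) auto

lemma cell_subset_parent: "B (\<epsilon> @ [b]) \<subseteq> B \<epsilon>"
  using cell_child_iff by blast

lemma cell_subset: "B \<epsilon> \<subseteq> \<X>"
  by (induction \<epsilon> rule: rev_induct) (use cell_subset_parent in auto)

lemma ex1_cell: "x \<in> \<X> \<Longrightarrow> \<exists>!\<epsilon>. length \<epsilon> = k \<and> x \<in> B \<epsilon>"
proof (induction k)
  case (Suc k)
  then obtain \<sigma> where \<sigma>: "length \<sigma> = k" "x \<in> B \<sigma>"
    and u: "\<And>\<tau>. length \<tau> = k \<Longrightarrow> x \<in> B \<tau> \<Longrightarrow> \<tau> = \<sigma>" by auto
  obtain b where b: "x \<in> B (\<sigma> @ [b])" using cell_children(1)[of \<sigma>] \<sigma> by blast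
  show ?case
  proof (rule ex1I[of _ "\<sigma> @ [b]"])
    fix \<tau> assume \<tau>: "length \<tau> = Suc k \<and> x \<in> B \<tau>"
    then obtain \<tau>' c where [simp]: "\<tau> = \<tau>' @ [c]" and "length \<tau>' = k"
      by (auto simp: length_Suc_conv_rev)
    with \<tau> u[of \<tau>'] cell_subset_parent[of \<tau>' c] have [simp]: "\<tau>' = \<sigma>" by auto
    show "\<tau> = \<sigma> @ [b]" using \<tau> b cell_child_iff[of x \<sigma> b] by (cases b; cases c) auto
  qed (use \<sigma> b in auto)
qed auto

lemma digits_cell: assumes "x \<in> \<X>" shows "length (digits B x k) = k" "x \<in> B (digits B x k)"
  using theI'[OF ex1_cell[OF assms, of k]] by (auto simp: digits_def)

lemma digits_eqI: "x \<in> B \<epsilon> \<Longrightarrow> length \<epsilon> = k \<Longrightarrow> digits B x k = \<epsilon>"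
  using ex1_cell[of x k] digits_cell[of x k] cell_subset[of \<epsilon>] by blast

lemma mem_cell_iff: "x \<in> \<X> \<Longrightarrow> x \<in> B \<epsilon> \<longleftrightarrow> digits B x (length \<epsilon>) = \<epsilon>"
  using digits_cell(2)[of x "length \<epsilon>"] digits_eqI[of x \<epsilon>] by auto

lemma sum_words_cell:
  "x \<in> \<X> \<Longrightarrow> (\<Sum>\<epsilon>\<in>words k. g \<epsilon> * indicator (B \<epsilon>) x) = (g (digits B x k) :: real)"
  by (subst sum.mono_neutral_right[of _ "{digits B x k}"])
    (auto simp: digits_cell digits_eqI split: split_indicator)

lemma indicator_cell_split:
  "indicator (B (\<epsilon> @ [False])) x + indicator (B (\<epsilon> @ [True])) x = (indicator (B \<epsilon>) x :: real)"
  using cell_children[of \<epsilon>] by (auto simp: indicator_def)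

text \<open>The deeper cell lies in its ancestor \<open>take (length \<epsilon>) \<delta>\<close>,
  and distinct words of equal length have disjoint cells.\<close>

lemma cell_inter:
  assumes "length \<epsilon> \<le> length \<delta>"
  shows "B \<epsilon> \<inter> B \<delta> = {} \<or> B \<epsilon> \<inter> B \<delta> = B \<delta>"
proof -
  have "B \<delta> \<subseteq> B (take k \<delta>)" if "k \<le> length \<delta>" for k
    using that
  proof (induction rule: inc_induct)
    case (step k)
    have "take (Suc k) \<delta> = take k \<delta> @ [\<delta> ! k]" using step by (simp add: take_Suc_conv_app_nth)
    with step cell_subset_parent[of "take k \<delta>" "\<delta> ! k"] show ?case by auto
  qed simp
  from this[OF assms] have sub: "B \<delta> \<subseteq> B (take (length \<epsilon>) \<delta>)" .
  show ?thesis
  proof (cases "take (length \<epsilon>) \<delta> = \<epsilon>")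
    case False
    then have "B (take (length \<epsilon>) \<delta>) \<inter> B \<epsilon> = {}"
      using assms digits_eqI[of _ \<epsilon> "length \<epsilon>"] digits_eqI[of _ "take (length \<epsilon>) \<delta>" "length \<epsilon>"] by fastforce
    then show ?thesis using sub by blast
  qed (use sub in auto)
qed

text \<open>With the empty set added, the generator is closed under intersection
  (\<open>Int_stable_cells\<close>), as Dynkin's theorem requires.\<close>

lemma sets_restrict_cells: "sets (restrict_space borel \<X>) = sigma_sets \<X> (insert {} (range B))"
proof -
  have "sigma_sets \<X> (insert {} (range B)) = sigma_sets \<X> (range B)"
    by (rule sigma_sets_eqI) (auto intro: sigma_sets.Empty)
  then show ?thesis using tree by (simp add: partition_tree_def)
qed

lemma Int_stable_cells: "Int_stable (insert {} (range B))"
proof (rule Int_stableI)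
  fix a b assume "a \<in> insert {} (range B)" "b \<in> insert {} (range B)"
  moreover have "B \<epsilon> \<inter> B \<delta> \<in> insert {} (range B)" for \<epsilon> \<delta>
    using cell_inter[of \<epsilon> \<delta>] cell_inter[of \<delta> \<epsilon>] by (cases "length \<epsilon> \<le> length \<delta>") (auto simp: Int_commute)
  ultimately show "a \<inter> b \<in> insert {} (range B)" by auto
qed

end

section \<open>Marginals of a Polya tree\<close>

context cell_tree
begin

lemma Y_child:
  assumes "sets P = sets (restrict_space borel \<X>)"
  shows "Y B P (\<sigma> @ [b]) = measure P (B (\<sigma> @ [b])) / measure P (B \<sigma>)"
proof -
  have "space P = \<X>" using sets_eq_imp_space_eq[OF assms] by (simp add: space_restrict_space)
  moreover have "{x \<in> \<X>. x \<in> B (\<sigma> @ [b]) \<and> x \<in> B \<sigma>} = B (\<sigma> @ [b])" "{x \<in> \<X>. x \<in> B \<sigma>} = B \<sigma>"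
    using cell_subset_parent cell_subset by blast+
  ultimately show ?thesis by (simp add: Y_def cond_prob_def)
qed

end

locale polya_law = cell_tree \<X> B for \<X> :: "'a::topological_space set" and B +
  fixes \<alpha> :: "bool list \<Rightarrow> real" and L :: "'a measure measure"
  assumes law: "polya_tree \<X> B \<alpha> L" and param_pos: "0 < \<alpha> \<epsilon>"
begin

sublocale prob_space L
  using law by (simp add: polya_tree_def)

lemma sets_L: "sets L = sets (prob_algebra (restrict_space borel \<X>))"
  using law by (simp add: polya_tree_def)

lemma space_L: "P \<in> space L \<longleftrightarrow> sets P = sets (restrict_space borel \<X>) \<and> prob_space P"
  using sets_eq_imp_space_eq[OF sets_L] by (simp add: space_prob_algebra)

lemma borel_measurable_measure_cell [measurable]: "(\<lambda>P. measure P (B \<epsilon>)) \<in> borel_measurable L"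
proof -
  have "B \<epsilon> \<in> sets (restrict_space borel \<X>)"
    by (subst sets_restrict_cells) (auto intro: sigma_sets.Basic)
  then show ?thesis
    by (subst measurable_cong_sets[OF sets_L refl]) simp
qed

lemma borel_measurable_Y [measurable]: "(\<lambda>P. Y B P (\<sigma> @ [b])) \<in> borel_measurable L"
proof -
  have "(\<lambda>P. measure P (B (\<sigma> @ [b])) / measure P (B \<sigma>)) \<in> borel_measurable L" by measurable
  then show ?thesis
    by (rule measurable_cong[THEN iffD1, rotated]) (simp add: Y_child space_L)
qed

lemma Y_distributed:
  "distributed L lborel (\<lambda>P. Y B P (\<sigma> @ [False])) (\<lambda>y. ennreal (beta_density (\<alpha> (\<sigma> @ [False])) (\<alpha> (\<sigma> @ [True])) y))"
  using law by (simp add: polya_tree_def)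

lemma AE_Y: "AE P in L. 0 < Y B P (\<sigma> @ [False]) \<and> Y B P (\<sigma> @ [False]) < 1 \<and>
    Y B P (\<sigma> @ [True]) = 1 - Y B P (\<sigma> @ [False])"
proof -
  have "AE y in lborel. 0 < ennreal (beta_density (\<alpha> (\<sigma> @ [False])) (\<alpha> (\<sigma> @ [True])) y) \<longrightarrow> 0 < y \<and> y < 1"
    by (rule AE_I2) (auto simp: beta_density_def)
  then have "AE P in L. 0 < Y B P (\<sigma> @ [False]) \<and> Y B P (\<sigma> @ [False]) < 1"
    by (subst distributed_AE2[OF Y_distributed]) auto
  then show ?thesis
    using AE_space
  proof eventually_elim
    case (elim P)
    then have P: "sets P = sets (restrict_space borel \<X>)" "prob_space P" by (auto simp: space_L)
    interpret P: prob_space P by fact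
    have "B \<epsilon> \<in> sets P" for \<epsilon>
      by (subst P, subst sets_restrict_cells) (auto intro: sigma_sets.Basic)
    then have "measure P (B \<sigma>) = measure P (B (\<sigma> @ [False])) + measure P (B (\<sigma> @ [True]))"
      using P.finite_measure_Union[of "B (\<sigma> @ [False])" "B (\<sigma> @ [True])"] cell_children[of \<sigma>] by simp
    \<comment> \<open>For a null parent the quotient defining \<open>Y\<close> would be 0 by the
      convention for division by zero, contradicting 0 < \<open>Y\<close>.\<close>
    moreover have "measure P (B \<sigma>) \<noteq> 0"
      using elim by (auto simp: Y_child[OF P(1)])
    ultimately show ?case
      using elim by (simp add: Y_child[OF P(1)] field_simps)
  qed
qed

lemma AE_Y_child: "AE P in L. 0 < Y B P (\<sigma> @ [b]) \<and> Y B P (\<sigma> @ [b]) < 1"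
  using AE_Y[of \<sigma>] by eventually_elim (cases b; simp)

text \<open>\<open>polya_tree\<close> prescribes the laws of the splits towards \<open>False\<close>
  only. For \<open>True\<close> the split is almost surely one minus its sibling, and the reflection
  of y to 1 - y exchanges the two Beta parameters.\<close>

lemma
  fixes g :: "real \<Rightarrow> real"
  assumes [measurable]: "g \<in> borel_measurable borel"
  shows integral_Y: "(LINT P|L. g (Y B P (\<sigma> @ [b])))
      = (LINT y|lborel. beta_density (\<alpha> (\<sigma> @ [b])) (\<alpha> (\<sigma> @ [\<not> b])) y * g y)"
    and integrable_Y: "integrable lborel (\<lambda>y. beta_density (\<alpha> (\<sigma> @ [b])) (\<alpha> (\<sigma> @ [\<not> b])) y * g y) \<Longrightarrow>
      integrable L (\<lambda>P. g (Y B P (\<sigma> @ [b])))"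
proof -
  let ?d = "beta_density (\<alpha> (\<sigma> @ [False])) (\<alpha> (\<sigma> @ [True]))"
  have nn: "0 \<le> ?d y" for y by (simp add: beta_density_nonneg param_pos)
  have F: "(LINT P|L. h (Y B P (\<sigma> @ [False]))) = (LINT y|lborel. ?d y * h y)"
    "integrable L (\<lambda>P. h (Y B P (\<sigma> @ [False]))) \<longleftrightarrow> integrable lborel (\<lambda>y. ?d y * h y)"
    if [measurable]: "h \<in> borel_measurable borel" for h :: "real \<Rightarrow> real"
    using distributed_integral[OF Y_distributed, of h \<sigma>] distributed_integrable[OF Y_distributed, of h \<sigma>] nn by auto
  have refl_eq: "?d (1 - y) = beta_density (\<alpha> (\<sigma> @ [True])) (\<alpha> (\<sigma> @ [False])) y" for y
    by (rule beta_density_reflect)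
  have ae: "AE P in L. g (Y B P (\<sigma> @ [True])) = g (1 - Y B P (\<sigma> @ [False]))"
    using AE_Y[of \<sigma>] by eventually_elim simp
  have T: "(LINT P|L. g (Y B P (\<sigma> @ [True]))) = (LINT P|L. g (1 - Y B P (\<sigma> @ [False])))"
    using ae by (intro integral_cong_AE) auto
  have T': "integrable L (\<lambda>P. g (Y B P (\<sigma> @ [True]))) \<longleftrightarrow> integrable L (\<lambda>P. g (1 - Y B P (\<sigma> @ [False])))"
    using ae by (intro integrable_cong_AE) auto
  have R: "(LINT y|lborel. ?d y * g (1 - y)) = (LINT y|lborel. beta_density (\<alpha> (\<sigma> @ [True])) (\<alpha> (\<sigma> @ [False])) y * g y)"
    by (subst lborel_integral_real_affine[where c="-1" and t=1]) (simp_all add: refl_eq)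
  show "(LINT P|L. g (Y B P (\<sigma> @ [b])))
      = (LINT y|lborel. beta_density (\<alpha> (\<sigma> @ [b])) (\<alpha> (\<sigma> @ [\<not> b])) y * g y)"
    using F(1)[of g] F(1)[of "\<lambda>y. g (1 - y)"] T R by (cases b) auto
  show "integrable L (\<lambda>P. g (Y B P (\<sigma> @ [b])))"
    if "integrable lborel (\<lambda>y. beta_density (\<alpha> (\<sigma> @ [b])) (\<alpha> (\<sigma> @ [\<not> b])) y * g y)"
  proof (cases b)
    case True
    with that have "integrable lborel (\<lambda>y. ?d (1 - y) * g (1 - (1 - y)))"
      by (simp add: refl_eq)
    from lborel_integrable_real_affine[OF this, of "-1" 1] have "integrable lborel (\<lambda>y. ?d y * g (1 - y))"
      by simp
    with True F(2)[of "\<lambda>y. g (1 - y)"] T' show ?thesis by simp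
  qed (use that F(2)[of g] in auto)
qed

lemma
  assumes "1 < \<alpha> (\<sigma> @ [b])"
  shows integrable_ln_Y: "integrable L (\<lambda>P. ln (2 * Y B P (\<sigma> @ [b])))"
    and integral_ln_Y: "(LINT P|L. ln (2 * Y B P (\<sigma> @ [b]))) = beta_log_mean (\<alpha> (\<sigma> @ [b])) (\<alpha> (\<sigma> @ [\<not> b]))"
    and integral_abs_ln_Y: "0 < s \<Longrightarrow> (LINT P|L. \<bar>ln (2 * Y B P (\<sigma> @ [b]))\<bar>)
      \<le> (s * (2 * \<alpha> (\<sigma> @ [b]) / (\<alpha> (\<sigma> @ [b]) + \<alpha> (\<sigma> @ [\<not> b])) - 2 +
          (\<alpha> (\<sigma> @ [b]) + \<alpha> (\<sigma> @ [\<not> b]) - 1) / (2 * (\<alpha> (\<sigma> @ [b]) - 1))) + 1 / s) / 2"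
proof -
  show "integrable L (\<lambda>P. ln (2 * Y B P (\<sigma> @ [b])))"
    using beta_abs_ln_bound(1)[OF assms param_pos zero_less_one] by (intro integrable_Y) auto
  show "(LINT P|L. ln (2 * Y B P (\<sigma> @ [b]))) = beta_log_mean (\<alpha> (\<sigma> @ [b])) (\<alpha> (\<sigma> @ [\<not> b]))"
    unfolding beta_log_mean_def by (rule integral_Y) auto
  have "(LINT P|L. \<bar>ln (2 * Y B P (\<sigma> @ [b]))\<bar>)
     = (LINT y|lborel. beta_density (\<alpha> (\<sigma> @ [b])) (\<alpha> (\<sigma> @ [\<not> b])) y * \<bar>ln (2 * y)\<bar>)"
    by (rule integral_Y) auto
  also have "\<dots> = (LINT y|lborel. \<bar>beta_density (\<alpha> (\<sigma> @ [b])) (\<alpha> (\<sigma> @ [\<not> b])) y * ln (2 * y)\<bar>)"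
    by (simp add: abs_mult beta_density_nonneg param_pos)
  finally show "(LINT P|L. \<bar>ln (2 * Y B P (\<sigma> @ [b]))\<bar>)
      \<le> (s * (2 * \<alpha> (\<sigma> @ [b]) / (\<alpha> (\<sigma> @ [b]) + \<alpha> (\<sigma> @ [\<not> b])) - 2 +
          (\<alpha> (\<sigma> @ [b]) + \<alpha> (\<sigma> @ [\<not> b]) - 1) / (2 * (\<alpha> (\<sigma> @ [b]) - 1))) + 1 / s) / 2" if "0 < s"
    using beta_abs_ln_bound(2)[OF assms param_pos that] by simp
qed

end

section \<open>Expansion of the estimator\<close>

text \<open>By monotone convergence the series of absolute values has a finite integral, so it is
  finite almost everywhere.\<close>

lemma AE_summable_of_integrals:
  fixes f :: "nat \<Rightarrow> 'a \<Rightarrow> real"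
  assumes f: "\<And>i. integrable M (f i)" and s: "summable (\<lambda>i. LINT x|M. \<bar>f i x\<bar>)"
  shows "AE x in M. summable (\<lambda>i. \<bar>f i x\<bar>)"
proof -
  have [measurable]: "f i \<in> borel_measurable M" for i using f by blast
  have "(\<integral>\<^sup>+x. (\<Sum>i. ennreal \<bar>f i x\<bar>) \<partial>M) = (\<Sum>i. \<integral>\<^sup>+x. ennreal \<bar>f i x\<bar> \<partial>M)"
    by (rule nn_integral_suminf) simp
  also have "\<dots> = (\<Sum>i. ennreal (LINT x|M. \<bar>f i x\<bar>))"
    using f by (intro arg_cong[where f=suminf] ext nn_integral_eq_integral) auto
  also have "\<dots> = ennreal (\<Sum>i. LINT x|M. \<bar>f i x\<bar>)"
    using s by (intro suminf_ennreal2) auto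
  finally have "(\<integral>\<^sup>+x. (\<Sum>i. ennreal \<bar>f i x\<bar>) \<partial>M) \<noteq> \<infinity>" by simp
  then have "AE x in M. (\<Sum>i. ennreal \<bar>f i x\<bar>) \<noteq> \<infinity>"
    by (intro nn_integral_PInf_AE) simp
  then show ?thesis
    by eventually_elim (auto intro: summable_suminf_not_top)
qed

text \<open>For c = \<beta> this keeps all parameters below the root at least 4, inside the range of
  the Beta estimates.\<close>

lemma four_le_two_powr:
  assumes "2 < (c::real)"
  shows "4 \<le> 2 powr (c * real (Suc l))"
proof -
  have "2 powr 2 \<le> 2 powr (c * real (Suc l))"
    using assms mult_mono[of 2 c 1 "real (Suc l)"] by (intro powr_mono) auto
  then show ?thesis by simp
qed

lemma summable_two_powr_Suc:
  assumes "0 < (c::real)"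
  shows "summable (\<lambda>j. 2 powr (- c * real (Suc j)))"
proof -
  have "2 powr (- c * real (Suc j)) = 2 powr (- c) * (2 powr (- c)) ^ j" for j
    by (simp add: powr_power powr_add[symmetric] algebra_simps)
  moreover have "2 powr (- c) < (1::real)"
    using assms by (simp add: powr_less_one)
  ultimately show ?thesis by (simp add: summable_mult summable_geometric)
qed

context cell_tree
begin

lemma digits_Suc: "x \<in> \<X> \<Longrightarrow> \<exists>b. digits B x (Suc j) = digits B x j @ [b]"
proof -
  assume x: "x \<in> \<X>"
  obtain \<sigma> b where s: "digits B x (Suc j) = \<sigma> @ [b]" "length \<sigma> = j"
    using digits_cell(1)[OF x, of "Suc j"] by (auto simp: length_Suc_conv_rev)
  have "x \<in> B \<sigma>" using digits_cell(2)[OF x, of "Suc j"] cell_subset_parent s(1) by auto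
  with s show ?thesis using digits_eqI[of x \<sigma> j] by auto
qed

lemma sample_count_child:
  "sample_count B n x (\<sigma> @ [False]) + sample_count B n x (\<sigma> @ [True]) = sample_count B n x \<sigma>"
  by (simp add: sample_count_def sum.distrib[symmetric] indicator_cell_split)

end

lemma sample_count_nonneg: "0 \<le> sample_count B n x \<epsilon>"
  by (simp add: sample_count_def sum_nonneg)

lemma sample_count_le: "sample_count B n x \<epsilon> \<le> real n"
proof -
  have "sample_count B n x \<epsilon> \<le> (\<Sum>i<n. 1)"
    unfolding sample_count_def by (rule sum_mono) (simp add: indicator_def)
  then show ?thesis by simp
qed

context polya_law
begin

text \<open>Summable absolute means make the series of logarithms converge absolutely almost surely
  and allow integration term by term.\<close>

lemma
  assumes x: "x \<in> \<X>" and gt: "\<And>\<epsilon>. \<epsilon> \<noteq> [] \<Longrightarrow> 1 < \<alpha> \<epsilon>"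
    and s: "summable (\<lambda>j. LINT P|L. \<bar>ln (2 * Y B P (digits B x (Suc j)))\<bar>)"
  shows ln_tree_density_sums:
      "(\<lambda>j. LINT P|L. ln (2 * Y B P (digits B x (Suc j)))) sums (LINT P|L. ln (tree_density B P x))"
    and integrable_ln_tree_density: "integrable L (\<lambda>P. ln (tree_density B P x))"
proof -
  define f where "f j P = ln (2 * Y B P (digits B x (Suc j)))" for j P
  have d: "\<exists>\<sigma> b. digits B x (Suc j) = \<sigma> @ [b]" for j using digits_Suc[OF x] by blast
  have Ym [measurable]: "(\<lambda>P. Y B P (digits B x (Suc j))) \<in> borel_measurable L" for j
    using d[of j] borel_measurable_Y by auto
  have f: "integrable L (f j)" for j
    using d[of j] integrable_ln_Y gt unfolding f_def by auto
  have ae: "AE P in L. summable (\<lambda>i. \<bar>f i P\<bar>)"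
    using AE_summable_of_integrals[OF f] s by (simp add: f_def)
  have "AE P in L. \<forall>j. 0 < Y B P (digits B x (Suc j))"
    unfolding AE_all_countable using d AE_Y_child by (metis (no_types, lifting) eventually_mono)
  then have eq: "AE P in L. ln (tree_density B P x) = (\<Sum>j. f j P)"
    using ae
  proof eventually_elim
    case (elim P)
    have "(\<Prod>j=1..k. 2 * Y B P (digits B x j)) = exp (\<Sum>j<k. f j P)" for k
    proof -
      have "(\<Prod>j=1..k. 2 * Y B P (digits B x j)) = (\<Prod>j<k. 2 * Y B P (digits B x (Suc j)))"
        by (rule prod.reindex_bij_witness[where i=Suc and j="\<lambda>j. j - 1"]) auto
      also have "\<dots> = (\<Prod>j<k. exp (f j P))"
        using elim by (intro prod.cong) (auto simp: f_def)
      finally show ?thesis by (simp add: exp_sum)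
    qed
    \<comment> \<open>Thus the \<open>lim\<close> in \<open>tree_density\<close> is a genuine limit,
      and a positive one, so \<open>ln\<close> recovers the series.\<close>
    moreover have "(\<lambda>k. exp (\<Sum>j<k. f j P)) \<longlonglongrightarrow> exp (\<Sum>j. f j P)"
      by (intro tendsto_exp summable_LIMSEQ) (rule summable_rabs_cancel[OF elim(2)])
    ultimately have "tree_density B P x = exp (\<Sum>j. f j P)"
      unfolding tree_density_def by (intro limI) simp
    then show ?case by simp
  qed
  have m: "(\<lambda>P. tree_density B P x) \<in> borel_measurable L"
    unfolding tree_density_def
  proof (rule borel_measurable_lim_metric)
    have "(\<lambda>P. Y B P (digits B x j)) \<in> borel_measurable L" if "j \<in> {1..k}" for j k
      using that Ym[of "j - 1"] by simp
    then show "(\<lambda>P. \<Prod>j=1..k. 2 * Y B P (digits B x j)) \<in> borel_measurable L" for k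
      by (intro borel_measurable_prod borel_measurable_times) auto
  qed
  have ns: "AE P in L. summable (\<lambda>i. norm (f i P))" "summable (\<lambda>i. LINT P|L. norm (f i P))"
    using ae s by (simp_all add: f_def)
  have fm [measurable]: "f i \<in> borel_measurable L" for i using f by blast
  have i2: "(LINT P|L. ln (tree_density B P x)) = (LINT P|L. (\<Sum>j. f j P))"
    using eq m by (intro integral_cong_AE) auto
  show "(\<lambda>j. LINT P|L. ln (2 * Y B P (digits B x (Suc j)))) sums (LINT P|L. ln (tree_density B P x))"
    unfolding i2 using sums_integral[OF f ns] by (simp add: f_def)
  show "integrable L (\<lambda>P. ln (tree_density B P x))"
    using integrable_suminf[OF f ns] eq m by (subst integrable_cong_AE) auto
qed

end

context cell_tree
begin

text \<open>Cells are grouped by their parent because a single child may have a negative limiting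
  contribution, whereas two siblings together have a nonnegative one. Hence the index
  \<open>Suc (length \<sigma>)\<close>.\<close>

definition node_sum :: "(nat \<Rightarrow> real) \<Rightarrow> (bool list \<Rightarrow> real) \<Rightarrow> bool list \<Rightarrow> real" where
  "node_sum a N \<sigma> = (\<Sum>b\<in>UNIV. N (\<sigma> @ [b]) *
     beta_log_mean (a (Suc (length \<sigma>)) + N (\<sigma> @ [b])) (a (Suc (length \<sigma>)) + N (\<sigma> @ [\<not> b])))"

text \<open>For a fixed sample the mean absolute logarithm of a split on level j is at most (n + 1)
  / sqrt (a j), a geometric sequence. This justifies both the termwise integration and the unordered
  summation; the second conclusion sums the same terms level by level. At n = 0 everything is 0 by
  the convention for division by zero.\<close>

theorem entropy_estimator_expansion:
  assumes a0: "0 < a 0" and a: "\<And>l. l \<ge> 1 \<Longrightarrow> a l = 2 powr (\<beta> * real l)" and \<beta>: "2 < \<beta>"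
    and x: "\<And>i. i < n \<Longrightarrow> x i \<in> \<X>"
    and L: "polya_tree \<X> B (posterior_param B (\<lambda>\<epsilon>. a (length \<epsilon>)) n x) L"
  shows "((\<lambda>\<epsilon>. sample_count B n x \<epsilon> / real n * (LINT P|L. ln (2 * Y B P \<epsilon>)))
      has_sum - entropy_estimator B L n x) {\<epsilon>. length \<epsilon> \<ge> 1}"
    and "(\<lambda>k. \<Sum>\<sigma>\<in>words k. node_sum a (sample_count B n x) \<sigma> / real n) sums - entropy_estimator B L n x"
proof -
  let ?N = "sample_count B n x" and ?\<alpha> = "posterior_param B (\<lambda>\<epsilon>. a (length \<epsilon>)) n x"
  have apos: "0 < a l" for l using a0 a[of l] by (cases "l = 0") auto
  have a4: "4 \<le> a (Suc l)" for l
    using four_le_two_powr[OF \<beta>, of l] a[of "Suc l"] by simp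
  interpret polya_law \<X> B ?\<alpha> L
    by unfold_locales (auto simp: L posterior_param_def intro!: add_pos_nonneg apos sample_count_nonneg)
  have gt: "1 < ?\<alpha> \<epsilon>" if "\<epsilon> \<noteq> []" for \<epsilon>
    using that a4[of "length \<epsilon> - 1"] sample_count_nonneg[of B n x \<epsilon>] by (simp add: posterior_param_def)
  define e where "e \<epsilon> = (LINT P|L. ln (2 * Y B P \<epsilon>))" for \<epsilon>
  have bound: "(LINT P|L. \<bar>ln (2 * Y B P (\<sigma> @ [b]))\<bar>) \<le> (real n + 1) / sqrt (a (Suc (length \<sigma>)))" for \<sigma> b
  proof -
    define A where "A = a (Suc (length \<sigma>))"
    define p q where "p = ?\<alpha> (\<sigma> @ [b])" and "q = ?\<alpha> (\<sigma> @ [\<not> b])"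
    have A: "4 \<le> A" using a4 by (simp add: A_def)
    have pq: "A \<le> p" "p \<le> A + n" "A \<le> q" "q \<le> A + n"
      using sample_count_nonneg sample_count_le by (auto simp: p_def q_def posterior_param_def A_def)
    \<comment> \<open>The means of 2 Y and of 1 / (2 Y). As the counts are at most n, these means
      exceed 1 by at most n / A and (n + 1) / A.\<close>
    define u v where "u = 2 * p / (p + q)" and "v = (p + q - 1) / (2 * (p - 1))"
    have u: "u - 1 \<le> n / A"
    proof -
      have "u - 1 = (p - q) / (p + q)" using pq A by (simp add: u_def field_simps)
      also have "\<dots> \<le> n / A" using pq A by (intro frac_le) auto
      finally show ?thesis .
    qed
    have v: "v - 1 \<le> (n + 1) / A"
    proof -
      have "v - 1 = (q - p + 1) / (2 * (p - 1))" using pq A by (simp add: v_def field_simps)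
      also have "\<dots> \<le> (n + 1) / A" using pq A by (intro frac_le) auto
      finally show ?thesis .
    qed
    have s: "0 < sqrt A" "A = sqrt A * sqrt A" using A by auto
    \<comment> \<open>The choice s = sqrt A balances s / A against 1 / s.\<close>
    have "(LINT P|L. \<bar>ln (2 * Y B P (\<sigma> @ [b]))\<bar>) \<le> (sqrt A * (u - 2 + v) + 1 / sqrt A) / 2"
      using integral_abs_ln_Y[OF gt s(1)] unfolding p_def q_def u_def v_def by simp
    also have "\<dots> \<le> (sqrt A * ((2 * real n + 1) / A) + 1 / sqrt A) / 2"
      using u v s(1) by (intro divide_right_mono add_right_mono mult_left_mono) (auto simp: add_divide_distrib)
    also have "sqrt A * ((2 * real n + 1) / A) = (2 * real n + 1) / sqrt A"
      using s by (metis nonzero_mult_divide_mult_cancel_left order_less_irrefl times_divide_eq_right)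
    also have "((2 * real n + 1) / sqrt A + 1 / sqrt A) / 2 = (real n + 1) / sqrt A"
      by (simp add: add_divide_distrib)
    finally show ?thesis by (simp add: A_def)
  qed
  have dom: "summable (\<lambda>j. (real n + 1) / sqrt (a (Suc j)))"
  proof -
    have "(real n + 1) / sqrt (a (Suc j)) = (real n + 1) * 2 powr (- (\<beta> / 2) * real (Suc j))" for j
    proof -
      have "sqrt (a (Suc j)) = 2 powr (\<beta> * real (Suc j) / 2)"
        by (simp only: powr_half_sqrt_powr a[of "Suc j", simplified]) simp
      also have "\<dots> = inverse (2 powr (- (\<beta> / 2) * real (Suc j)))"
        by (subst powr_minus[symmetric]) simp
      finally show ?thesis by (simp only: divide_inverse inverse_inverse_eq)
    qed
    then show ?thesis using \<beta> by (simp only:) (intro summable_mult summable_two_powr_Suc, simp)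
  qed
  have abs_bound: "(LINT P|L. \<bar>ln (2 * Y B P (digits B y (Suc j)))\<bar>) \<le> (real n + 1) / sqrt (a (Suc j))"
    if "y \<in> \<X>" for y j
    using digits_Suc[OF that, of j] bound[of "digits B y j"] digits_cell(1)[OF that, of j] by auto
  have s: "summable (\<lambda>j. LINT P|L. \<bar>ln (2 * Y B P (digits B y (Suc j)))\<bar>)" if "y \<in> \<X>" for y
    by (rule summable_comparison_test'[OF dom, of 0]) (use abs_bound[OF that] in simp)
  note dens = ln_tree_density_sums[OF _ gt s, folded e_def] integrable_ln_tree_density[OF _ gt s]
  define c where "c i = (LINT P|L. ln (tree_density B P (x i)))" for i
  have c: "(\<lambda>j. e (digits B (x i) (Suc j))) sums c i" if "i < n" for i
    unfolding c_def using x[OF that] by (intro dens(1))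
  have est: "- entropy_estimator B L n x = (\<Sum>i<n. 1 / n * c i)"
    unfolding entropy_estimator_def c_def
    using x by (simp add: Bochner_Integration.integral_sum dens(2) sum_distrib_left sum_divide_distrib)
  \<comment> \<open>A sample point lies in exactly one cell of each level, so only the words along
    its digit path contribute.\<close>
  have hs: "((\<lambda>\<epsilon>. indicator (B \<epsilon>) (x i) / n * e \<epsilon>) has_sum (1 / n * c i)) {\<epsilon>. length \<epsilon> \<ge> 1}" if i: "i < n" for i
  proof -
    define d where "d j = digits B (x i) (Suc j)" for j
    note xi = x[OF i]
    have inj: "inj d"
    proof (rule injI)
      fix j k assume "d j = d k"
      then have "length (d j) = length (d k)" by simp
      then show "j = k" by (simp add: d_def digits_cell[OF xi])
    qed
    have "summable (\<lambda>j. norm (e (d j)))"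
    proof (rule summable_comparison_test'[OF dom, of 0])
      fix j
      have "norm (e (d j)) \<le> (LINT P|L. \<bar>ln (2 * Y B P (d j))\<bar>)" unfolding e_def by simp
      also have "\<dots> \<le> (real n + 1) / sqrt (a (Suc j))" unfolding d_def by (rule abs_bound[OF xi])
      finally show "norm (norm (e (d j))) \<le> (real n + 1) / sqrt (a (Suc j))" by simp
    qed
    then have "((\<lambda>j. e (d j)) has_sum c i) UNIV"
      using c[OF i] by (intro norm_summable_imp_has_sum) (simp_all add: d_def)
    then have "(e has_sum c i) (range d)"
      using has_sum_reindex[OF inj, of e "c i"] by (simp add: comp_def)
    then have "((\<lambda>\<epsilon>. 1 / n * e \<epsilon>) has_sum (1 / n * c i)) (range d)"
      by (rule has_sum_cmult_right)
    then show ?thesis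
    proof (rule has_sum_cong_neutral[THEN iffD1, rotated -1])
      fix \<epsilon> assume "\<epsilon> \<in> {\<epsilon>. length \<epsilon> \<ge> 1} - range d"
      then have "x i \<notin> B \<epsilon>"
        using mem_cell_iff[OF xi, of \<epsilon>] by (cases "length \<epsilon>") (auto simp: d_def)
      then show "indicator (B \<epsilon>) (x i) / n * e \<epsilon> = 0" by simp
    qed (use digits_cell[OF xi] in \<open>auto simp: d_def\<close>)
  qed
  have "((\<lambda>\<epsilon>. \<Sum>i<m. indicator (B \<epsilon>) (x i) / n * e \<epsilon>) has_sum (\<Sum>i<m. 1 / n * c i)) {\<epsilon>. length \<epsilon> \<ge> 1}"
    if "m \<le> n" for m
    using that
  proof (induction m)
    case (Suc m)
    then show ?case unfolding sum.lessThan_Suc by (intro has_sum_add hs) auto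
  qed (simp add: has_sum_0)
  from this[of n] show "((\<lambda>\<epsilon>. ?N \<epsilon> / real n * (LINT P|L. ln (2 * Y B P \<epsilon>)))
      has_sum - entropy_estimator B L n x) {\<epsilon>. length \<epsilon> \<ge> 1}"
    by (simp add: est e_def sample_count_def sum_divide_distrib sum_distrib_right)
  have level: "(\<Sum>i<n. 1 / n * e (digits B (x i) (Suc k))) = (\<Sum>\<sigma>\<in>words k. node_sum a ?N \<sigma> / n)" for k
  proof -
    have "(\<Sum>i<n. 1 / n * e (digits B (x i) (Suc k))) = (\<Sum>i<n. \<Sum>\<epsilon>\<in>words (Suc k). 1 / n * e \<epsilon> * indicator (B \<epsilon>) (x i))"
      using x by (intro sum.cong refl) (simp only: sum_words_cell lessThan_iff)
    also have "\<dots> = (\<Sum>\<epsilon>\<in>words (Suc k). ?N \<epsilon> / n * e \<epsilon>)"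
      by (subst sum.swap) (simp add: sample_count_def sum_distrib_left sum_distrib_right sum_divide_distrib mult_ac)
    also have "\<dots> = (\<Sum>\<sigma>\<in>words k. node_sum a ?N \<sigma> / n)"
    proof (subst sum_words_Suc, rule sum.cong)
      fix \<sigma> assume "\<sigma> \<in> words k"
      have "e (\<sigma> @ [b]) = beta_log_mean (a (Suc (length \<sigma>)) + ?N (\<sigma> @ [b])) (a (Suc (length \<sigma>)) + ?N (\<sigma> @ [\<not> b]))" for b
        unfolding e_def by (simp add: integral_ln_Y gt) (simp add: posterior_param_def)
      then show "?N (\<sigma> @ [False]) / n * e (\<sigma> @ [False]) + ?N (\<sigma> @ [True]) / n * e (\<sigma> @ [True]) = node_sum a ?N \<sigma> / n"
        by (simp add: node_sum_def UNIV_bool add_divide_distrib)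
    qed simp
    finally show ?thesis .
  qed
  have "(\<lambda>k. \<Sum>i<n. 1 / n * e (digits B (x i) (Suc k))) sums (\<Sum>i<n. 1 / n * c i)"
    by (intro sums_sum sums_mult c) simp
  then show "(\<lambda>k. \<Sum>\<sigma>\<in>words k. node_sum a ?N \<sigma> / n) sums - entropy_estimator B L n x"
    by (simp only: level est)
qed

end

section \<open>Contribution of a single cell\<close>

text \<open>\<open>mean_split A u v\<close> is \<open>n\<close> times the contribution of a cell whose halves have prior
  parameter \<open>A\<close> and counts \<open>u\<close>, \<open>v\<close>; \<open>log_split\<close> replaces the posterior mean of the logarithm by
  the logarithm of the posterior mean.\<close>

definition log_split :: "real \<Rightarrow> real \<Rightarrow> real \<Rightarrow> real" where
  "log_split A u v = u * ln (2 * (A + u) / (2 * A + u + v)) + v * ln (2 * (A + v) / (2 * A + u + v))"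

definition mean_split :: "real \<Rightarrow> real \<Rightarrow> real \<Rightarrow> real" where
  "mean_split A u v = u * beta_log_mean (A + u) (A + v) + v * beta_log_mean (A + v) (A + u)"

lemma mean_split_le_log_split:
  assumes "2 \<le> A" "0 \<le> u" "0 \<le> v"
  shows "mean_split A u v \<le> log_split A u v"
proof -
  have "beta_log_mean (A + u) (A + v) \<le> ln (2 * (A + u) / (2 * A + u + v))"
    "beta_log_mean (A + v) (A + u) \<le> ln (2 * (A + v) / (2 * A + u + v))"
    using beta_log_mean_upper[of "A + u" "A + v"] beta_log_mean_upper[of "A + v" "A + u"] assms
    by (simp_all add: algebra_simps)
  then show ?thesis
    using assms by (auto simp: mean_split_def log_split_def intro!: add_mono mult_left_mono)
qed

text \<open>A half with count u loses at most 2 u / (A + u), which is bounded both by 2 u / A and by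
  2. After division by n the first form is small for deep cells uniformly in n, the second for a
  fixed cell as n grows.\<close>

lemma log_split_le_mean_split:
  assumes "2 \<le> A" "0 \<le> u" "0 \<le> v"
  shows "log_split A u v \<le> mean_split A u v + 2 * (u + v) / A"
    and "log_split A u v \<le> mean_split A u v + 4"
proof -
  have "ln (2 * (A + u) / (2 * A + u + v)) - 2 / (A + u) \<le> beta_log_mean (A + u) (A + v)"
    "ln (2 * (A + v) / (2 * A + u + v)) - 2 / (A + v) \<le> beta_log_mean (A + v) (A + u)"
    using beta_log_mean_lower[of "A + u" "A + v"] beta_log_mean_lower[of "A + v" "A + u"] assms
    by (simp_all add: algebra_simps)
  from mult_left_mono[OF this(1) assms(2)] mult_left_mono[OF this(2) assms(3)]
  have *: "log_split A u v - mean_split A u v \<le> u * (2 / (A + u)) + v * (2 / (A + v))"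
    by (simp add: mean_split_def log_split_def algebra_simps)
  have "u * (2 / (A + u)) \<le> u * (2 / A)" "v * (2 / (A + v)) \<le> v * (2 / A)"
    using assms by (auto intro!: mult_left_mono frac_le)
  with * show "log_split A u v \<le> mean_split A u v + 2 * (u + v) / A"
    by (simp add: add_divide_distrib distrib_left mult.commute)
  have "u * (2 / (A + u)) \<le> 2" "v * (2 / (A + v)) \<le> 2"
    using assms by (auto simp: divide_le_eq)
  with * show "log_split A u v \<le> mean_split A u v + 4" by simp
qed

text \<open>By ln t \<ge> 1 - 1 / t the sum is at least half the product of u - v and u / (A + u) -
  v / (A + v). These factors have the same sign because r / (A + r) increases with r.\<close>

lemma log_split_nonneg:
  assumes "0 < A" "0 \<le> u" "0 \<le> v"
  shows "0 \<le> log_split A u v"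
proof -
  have ln_ge: "(r - s) / (2 * (A + r)) \<le> ln (2 * (A + r) / (2 * A + r + s))" if "0 \<le> r" "0 \<le> s" for r s
  proof -
    have "ln ((2 * A + r + s) / (2 * (A + r))) \<le> (2 * A + r + s) / (2 * (A + r)) - 1"
      using assms that by (intro ln_le_minus_one) simp
    moreover have "ln ((2 * A + r + s) / (2 * (A + r))) = - ln (2 * (A + r) / (2 * A + r + s))"
      using assms that by (simp add: ln_div)
    moreover have "1 - (2 * A + r + s) / (2 * (A + r)) = (r - s) / (2 * (A + r))"
      using assms that by (simp add: field_simps)
    ultimately show ?thesis by linarith
  qed
  have "0 \<le> (u - v) * (u / (A + u) - v / (A + v)) / 2"
  proof -
    have "u / (A + u) - v / (A + v) = A * (u - v) / ((A + u) * (A + v))"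
      using assms by (simp add: field_simps)
    then have "(u - v) * (u / (A + u) - v / (A + v)) = A * (u - v)\<^sup>2 / ((A + u) * (A + v))"
      by (simp add: power2_eq_square mult_ac)
    then show ?thesis using assms by simp
  qed
  also have "\<dots> = u * ((u - v) / (2 * (A + u))) + v * ((v - u) / (2 * (A + v)))"
    using assms by (simp add: divide_simps) (simp add: algebra_simps)
  also have "\<dots> \<le> u * ln (2 * (A + u) / (2 * A + u + v)) + v * ln (2 * (A + v) / (2 * A + v + u))"
    using assms ln_ge[of u v] ln_ge[of v u] by (intro add_mono mult_left_mono) auto
  finally show ?thesis by (simp add: log_split_def algebra_simps)
qed

lemma log_split_le_ln2:
  assumes "0 < A" "0 \<le> u" "0 \<le> v"
  shows "log_split A u v \<le> (u + v) * ln 2"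
proof -
  have le: "ln (2 * (A + r) / (2 * A + u + v)) \<le> ln 2" if "r = u \<or> r = v" for r
    using assms that by (subst ln_le_cancel_iff) (auto simp: field_simps)
  have "log_split A u v \<le> u * ln 2 + v * ln 2"
    unfolding log_split_def using assms by (intro add_mono mult_left_mono le) auto
  then show ?thesis by (simp add: distrib_right)
qed

text \<open>The effect of the shrinkage: a doubled posterior mean exceeds 1 by at most (u + v) / (2
  A), and ln t \<le> t - 1.\<close>

lemma log_split_le_square:
  assumes "0 < A" "0 \<le> u" "0 \<le> v"
  shows "log_split A u v \<le> (u + v)\<^sup>2 / (2 * A)"
proof -
  have le: "ln (2 * (A + r) / (2 * A + u + v)) \<le> (u + v) / (2 * A)" if "r = u \<or> r = v" for r
  proof -
    have "ln (2 * (A + r) / (2 * A + u + v)) \<le> 2 * (A + r) / (2 * A + u + v) - 1"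
      using assms that by (intro ln_le_minus_one) auto
    also have "\<dots> = (2 * r - (u + v)) / (2 * A + u + v)" using assms by (simp add: field_simps)
    also have "\<dots> \<le> (u + v) / (2 * A)" using assms that by (intro frac_le) auto
    finally show ?thesis .
  qed
  have "log_split A u v \<le> u * ((u + v) / (2 * A)) + v * ((u + v) / (2 * A))"
    unfolding log_split_def using assms by (intro add_mono mult_left_mono le) auto
  also have "\<dots> = (u + v)\<^sup>2 / (2 * A)"
    unfolding distrib_right[symmetric] by (simp add: power2_eq_square)
  finally show ?thesis .
qed

text \<open>Three applications of \<open>ln t \<le> t - 1\<close>: from the shrunken to the empirical splitting
  frequencies, and from the empirical to the true weights \<open>p\<close>, \<open>q\<close> of the two halves. Only second
  moments of the counts \<open>u\<close>, \<open>v\<close> out of \<open>m\<close> are left on the right.\<close>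

lemma log_split_le_weights:
  assumes A: "0 < A" and u: "0 \<le> u" and v: "0 \<le> v" and m: "0 < m" and p: "0 < p" and q: "0 < q"
  shows "log_split A u v \<le> u * ln (2 * p / (p + q)) + v * ln (2 * q / (p + q))
    + u\<^sup>2 / (m * p) + v\<^sup>2 / (m * q) - 2 * (u + v) + m * (p + q)"
proof (cases "u + v = 0")
  case True
  then have "u = 0" "v = 0" using u v by auto
  then show ?thesis using m p q by (simp add: log_split_def)
next
  case False
  define N where "N = u + v"
  have N: "0 < N" using False u v by (simp add: N_def)
  have half: "r * ln (2 * (A + r) / (2 * A + N)) \<le> r * ln (2 * w / (p + q))
      + ((A + r) / (2 * A + N) * N - r) + (r\<^sup>2 / (m * w) - r) + r * (m * (p + q) / N - 1)"
    if r: "0 \<le> r" and w: "0 < w" for r w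
  proof (cases "r = 0")
    case True
    then show ?thesis using A N by simp
  next
    case False
    with r have r: "0 < r" by simp
    define s where "s = (A + r) / (2 * A + N)"
    have s: "0 < s" using A N r by (simp add: s_def)
    \<comment> \<open>The factorization 2 s = (2 w / (p + q)) (s N / r) (r / (m w)) (m (p + q) / N);
      each factor after the first is compared with 1.\<close>
    have "ln (2 * s) = ln (2 * w / (p + q)) + ln (s * N / r) + ln (r / (m * w)) + ln (m * (p + q) / N)"
      using s N r w m p q by (simp add: ln_mult ln_div)
    also have "\<dots> \<le> ln (2 * w / (p + q)) + (s * N / r - 1) + (r / (m * w) - 1) + (m * (p + q) / N - 1)"
      using s N r w m p q by (intro add_mono ln_le_minus_one order_refl) auto
    finally have "r * ln (2 * s) \<le> r * (ln (2 * w / (p + q)) + (s * N / r - 1) + (r / (m * w) - 1) + (m * (p + q) / N - 1))"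
      using r by (intro mult_left_mono) auto
    also have "\<dots> = r * ln (2 * w / (p + q)) + (s * N - r) + (r\<^sup>2 / (m * w) - r) + r * (m * (p + q) / N - 1)"
      using r by (simp add: distrib_left right_diff_distrib power2_eq_square)
    finally show ?thesis by (simp add: s_def)
  qed
  \<comment> \<open>The shrunken frequencies of the halves add up to 1, so their error terms cancel
    in the sum.\<close>
  have "(A + u) / (2 * A + N) * N + (A + v) / (2 * A + N) * N = N"
  proof -
    have "(A + u) / (2 * A + N) * N + (A + v) / (2 * A + N) * N = (2 * A + N) / (2 * A + N) * N"
      by (simp add: N_def add_divide_distrib[symmetric] distrib_right[symmetric])
    then show ?thesis using A N by simp
  qed
  moreover have "u * (m * (p + q) / N - 1) + v * (m * (p + q) / N - 1) = m * (p + q) - N"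
  proof -
    have "u * (m * (p + q) / N - 1) + v * (m * (p + q) / N - 1) = N * (m * (p + q) / N - 1)"
      by (simp add: N_def distrib_right[symmetric])
    then show ?thesis using N by (simp add: right_diff_distrib)
  qed
  moreover have "log_split A u v = u * ln (2 * (A + u) / (2 * A + N)) + v * ln (2 * (A + v) / (2 * A + N))"
    by (simp add: log_split_def N_def add.assoc)
  ultimately show ?thesis
    using half[OF u p] half[OF v q] by (simp add: N_def)
qed

text \<open>Scaling the prior parameter and the counts by 1 / n leaves the logarithms unchanged, so
  \<open>log_split\<close> over n is a function of A / n and the two frequencies, and the prior
  washes out. The limit along a product filter yields \<open>n0\<close> and \<open>d\<close>
  independent of the counts.\<close>

lemma log_split_limit:
  assumes "0 < p" "0 < q" "0 < e"
  obtains n0 d where "0 < d" "\<And>n u v. n0 \<le> n \<Longrightarrow> \<bar>u / real n - p\<bar> < d \<Longrightarrow> \<bar>v / real n - q\<bar> < d \<Longrightarrow>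
    \<bar>log_split A u v / real n - (p * ln (2 * p / (p + q)) + q * ln (2 * q / (p + q)))\<bar> < e"
proof -
  define F where "F = (\<lambda>z :: nat \<times> real \<times> real. case z of (n, s, t) \<Rightarrow>
    s * ln (2 * (A / n + s) / (2 * (A / n) + s + t)) + t * ln (2 * (A / n + t) / (2 * (A / n) + s + t)))"
  let ?l = "p * ln (2 * p / (p + q)) + q * ln (2 * q / (p + q))"
  let ?F = "sequentially \<times>\<^sub>F nhds p \<times>\<^sub>F nhds q"
  have s: "((\<lambda>z. fst (snd z)) \<longlongrightarrow> p) ?F"
    by (rule filterlim_compose[OF filterlim_fst filterlim_snd])
  have t: "((\<lambda>z. snd (snd z)) \<longlongrightarrow> q) ?F"
    by (rule filterlim_compose[OF filterlim_snd filterlim_snd])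
  have n: "((\<lambda>z. A / real (fst z)) \<longlongrightarrow> 0) ?F"
    by (rule filterlim_compose[OF _ filterlim_fst]) (rule lim_const_over_n)
  have "((\<lambda>z. fst (snd z) * ln (2 * (A / real (fst z) + fst (snd z)) / (2 * (A / real (fst z)) + fst (snd z) + snd (snd z)))
      + snd (snd z) * ln (2 * (A / real (fst z) + snd (snd z)) / (2 * (A / real (fst z)) + fst (snd z) + snd (snd z))))
    \<longlongrightarrow> p * ln (2 * (0 + p) / (2 * 0 + p + q)) + q * ln (2 * (0 + q) / (2 * 0 + p + q))) ?F"
    by (intro tendsto_intros s t n) (use assms in auto)
  then have "(F \<longlongrightarrow> ?l) ?F"
    by (simp add: F_def case_prod_beta')
  from tendstoD[OF this \<open>0 < e\<close>]
  obtain P Q R where P: "eventually P sequentially" and Q: "eventually Q (nhds p)" and R: "eventually R (nhds q)"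
    and PQR: "\<And>n s t. P n \<Longrightarrow> Q s \<Longrightarrow> R t \<Longrightarrow> dist (F (n, s, t)) ?l < e"
    unfolding eventually_prod_filter by force
  obtain n0 where n0: "\<And>n. n0 \<le> n \<Longrightarrow> P n" using P by (auto simp: eventually_sequentially)
  obtain d1 where d1: "0 < d1" "\<And>s. dist s p < d1 \<Longrightarrow> Q s" using Q by (auto simp: eventually_nhds_metric)
  obtain d2 where d2: "0 < d2" "\<And>t. dist t q < d2 \<Longrightarrow> R t" using R by (auto simp: eventually_nhds_metric)
  show thesis
  \<comment> \<open>The 1 excludes n = 0, where the scaling cannot be cancelled.\<close>
  proof (rule that[of "min d1 d2" "max 1 n0"])
    fix n u v assume n: "max 1 n0 \<le> n" and u: "\<bar>u / real n - p\<bar> < min d1 d2" and v: "\<bar>v / real n - q\<bar> < min d1 d2"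
    have n1: "0 < real n" using n by simp
    have frac: "2 * (A / n + r / n) / (2 * (A / n) + u / n + v / n) = 2 * (A + r) / (2 * A + u + v)" for r
    proof -
      have "2 * (A / n + r / n) = 2 * (A + r) / n" "2 * (A / n) + u / n + v / n = (2 * A + u + v) / n"
        by (simp_all add: add_divide_distrib)
      then show ?thesis using n1 by simp
    qed
    have "F (n, u / n, v / n) = log_split A u v / n"
      unfolding F_def prod.case frac log_split_def
      by (simp only: times_divide_eq_left add_divide_distrib)
    moreover have "dist (F (n, u / n, v / n)) ?l < e"
      using n u v by (intro PQR n0 d1 d2) (auto simp: dist_real_def)
    ultimately show "\<bar>log_split A u v / real n - ?l\<bar> < e" by (simp add: dist_real_def)
  qed (use d1 d2 in auto)
qed

section \<open>Cell averages and the entropy\<close>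

locale dyadic_tree = cell_tree \<X> B for \<X> :: "'a::euclidean_space set" and B +
  assumes cell_measure: "measure lborel (B \<epsilon>) = (1 / 2) ^ length \<epsilon>"
begin

abbreviation \<mu> :: "'a measure" where "\<mu> \<equiv> restrict_space lborel \<X>"

lemma space_mu [simp]: "space \<mu> = \<X>"
  by (simp add: space_restrict_space)

lemma sets_mu: "sets \<mu> = sigma_sets \<X> (insert {} (range B))"
  using sets_restrict_cells by (simp add: sets_restrict_space)

lemma cell_in_mu [measurable]: "B \<epsilon> \<in> sets \<mu>"
  by (subst sets_mu) (auto intro: sigma_sets.Basic)

lemma measure_mu_cell: "measure \<mu> (B \<epsilon>) = (1 / 2) ^ length \<epsilon>"
  using cell_measure[of \<epsilon>] cell_subset[of \<epsilon>] by (subst measure_restrict_space) auto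

lemma prob_space_mu: "prob_space \<mu>"
proof
  have "measure lborel \<X> = 1" using cell_measure[of "[]"] by simp
  then have "emeasure lborel \<X> = 1"
    \<comment> \<open>An infinite \<open>emeasure\<close> would give \<open>measure\<close> the
      value 0.\<close>
    by (metis emeasure_eq_ennreal_measure ennreal_1 measure_def enn2real_top zero_neq_one)
  then show "emeasure \<mu> (space \<mu>) = 1"
    by (subst emeasure_restrict_space) auto
qed

sublocale mu: prob_space \<mu>
  by (rule prob_space_mu)

definition cell_integral :: "('a \<Rightarrow> real) \<Rightarrow> bool list \<Rightarrow> real" where
  "cell_integral f \<epsilon> = (LINT y|\<mu>. f y * indicator (B \<epsilon>) y)"

text \<open>The conditional expectation of \<open>f\<close> given the level-\<open>k\<close> cells, each of measure \<open>2\<^sup>-\<^sup>k\<close>.\<close>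

definition cell_avg :: "nat \<Rightarrow> ('a \<Rightarrow> real) \<Rightarrow> 'a \<Rightarrow> real" where
  "cell_avg k f x = (\<Sum>\<epsilon>\<in>words k. 2 ^ k * cell_integral f \<epsilon> * indicator (B \<epsilon>) x)"

lemma integrable_cell: "integrable \<mu> f \<Longrightarrow> integrable \<mu> (\<lambda>y. f y * indicator (B \<epsilon>) y :: real)"
  by (rule integrable_real_mult_indicator) auto

lemma integrable_indicator_cell [simp]: "integrable \<mu> (indicator (B \<epsilon>) :: 'a \<Rightarrow> real)"
  by (simp add: less_top[symmetric])

lemma integral_indicator_cell: "(LINT x|\<mu>. indicator (B \<epsilon>) x) = ((1/2) ^ length \<epsilon> :: real)"
  using cell_subset[of \<epsilon>] by (simp add: measure_mu_cell Int_absorb2)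

lemma cell_avg_eq: "x \<in> \<X> \<Longrightarrow> cell_avg k f x = 2 ^ k * cell_integral f (digits B x k)"
  unfolding cell_avg_def by (rule sum_words_cell)

lemma integrable_comp_cell_avg: "integrable \<mu> (\<lambda>x. h (cell_avg k f x) :: real)"
  and integral_comp_cell_avg: "(LINT x|\<mu>. h (cell_avg k f x)) = (\<Sum>\<epsilon>\<in>words k. h (2 ^ k * cell_integral f \<epsilon>) * (1/2) ^ k)"
proof -
  have eq: "h (cell_avg k f x) = (\<Sum>\<epsilon>\<in>words k. h (2 ^ k * cell_integral f \<epsilon>) * indicator (B \<epsilon>) x)" if "x \<in> \<X>" for x
    using sum_words_cell[OF that, of "\<lambda>\<epsilon>. h (2 ^ k * cell_integral f \<epsilon>)" k] by (simp only: cell_avg_eq[OF that])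
  show "integrable \<mu> (\<lambda>x. h (cell_avg k f x))"
    by (subst Bochner_Integration.integrable_cong[OF refl eq], simp)
      (intro Bochner_Integration.integrable_sum integrable_mult_right integrable_indicator_cell)
  have "(LINT x|\<mu>. h (cell_avg k f x)) = (LINT x|\<mu>. (\<Sum>\<epsilon>\<in>words k. h (2 ^ k * cell_integral f \<epsilon>) * indicator (B \<epsilon>) x))"
    by (rule Bochner_Integration.integral_cong) (auto simp: eq)
  also have "\<dots> = (\<Sum>\<epsilon>\<in>words k. h (2 ^ k * cell_integral f \<epsilon>) * (1/2) ^ k)"
    by (subst Bochner_Integration.integral_sum) (auto intro!: sum.cong simp: measure_mu_cell Int_absorb2[OF cell_subset])
  finally show "(LINT x|\<mu>. h (cell_avg k f x)) = (\<Sum>\<epsilon>\<in>words k. h (2 ^ k * cell_integral f \<epsilon>) * (1/2) ^ k)" .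
qed

lemma integrable_cell_avg [simp]: "integrable \<mu> (cell_avg k f)"
  using integrable_comp_cell_avg[of "\<lambda>x. x"] by simp

lemma sum_cell_integral: "integrable \<mu> f \<Longrightarrow> (\<Sum>\<epsilon>\<in>words k. g \<epsilon> * cell_integral f \<epsilon>) = (LINT x|\<mu>. g (digits B x k) * f x)"
  and integrable_digits: "integrable \<mu> f \<Longrightarrow> integrable \<mu> (\<lambda>x. g (digits B x k) * f x)"
proof -
  assume f: "integrable \<mu> f"
  have eq: "g (digits B x k) * f x = (\<Sum>\<epsilon>\<in>words k. g \<epsilon> * (f x * indicator (B \<epsilon>) x))" if "x \<in> \<X>" for x
    using sum_words_cell[OF that, of "\<lambda>\<epsilon>. g \<epsilon> * f x" k] by (simp add: mult.assoc)
  show "integrable \<mu> (\<lambda>x. g (digits B x k) * f x)"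
    by (subst Bochner_Integration.integrable_cong[OF refl eq]) (auto intro!: integrable_cell f)
  have "(LINT x|\<mu>. g (digits B x k) * f x) = (LINT x|\<mu>. (\<Sum>\<epsilon>\<in>words k. g \<epsilon> * (f x * indicator (B \<epsilon>) x)))"
    by (rule Bochner_Integration.integral_cong) (auto simp: eq)
  also have "\<dots> = (\<Sum>\<epsilon>\<in>words k. g \<epsilon> * cell_integral f \<epsilon>)"
    by (subst Bochner_Integration.integral_sum) (auto intro!: integrable_cell f simp: cell_integral_def)
  finally show "(\<Sum>\<epsilon>\<in>words k. g \<epsilon> * cell_integral f \<epsilon>) = (LINT x|\<mu>. g (digits B x k) * f x)" ..
qed

lemma cell_avg_diff:
  "integrable \<mu> f \<Longrightarrow> integrable \<mu> g \<Longrightarrow> cell_avg k (\<lambda>x. f x - g x) x = cell_avg k f x - cell_avg k g x"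
  by (simp add: cell_avg_def cell_integral_def left_diff_distrib right_diff_distrib integrable_cell sum_subtractf)

lemma cell_avg_add:
  "integrable \<mu> f \<Longrightarrow> integrable \<mu> g \<Longrightarrow> cell_avg k (\<lambda>x. f x + g x) x = cell_avg k f x + cell_avg k g x"
  by (simp add: cell_avg_def cell_integral_def distrib_left distrib_right integrable_cell sum.distrib)

lemma cell_avg_scale: "cell_avg k (\<lambda>x. c * f x) x = c * cell_avg k f x"
  by (simp add: cell_avg_def cell_integral_def mult.assoc sum_distrib_left mult.left_commute)

section \<open>Convergence in mean of the cell averages\<close>

lemma cell_avg_contraction:
  assumes f: "integrable \<mu> f"
  shows "(LINT x|\<mu>. \<bar>cell_avg k f x\<bar>) \<le> (LINT x|\<mu>. \<bar>f x\<bar>)"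
proof -
  have "(LINT x|\<mu>. \<bar>cell_avg k f x\<bar>) = (\<Sum>\<epsilon>\<in>words k. \<bar>cell_integral f \<epsilon>\<bar>)"
    by (subst integral_comp_cell_avg[of abs]) (simp add: abs_mult power_one_over)
  also have "\<dots> \<le> (\<Sum>\<epsilon>\<in>words k. 1 * cell_integral (\<lambda>x. \<bar>f x\<bar>) \<epsilon>)"
  proof (rule sum_mono)
    fix \<epsilon>
    have "\<bar>cell_integral f \<epsilon>\<bar> \<le> (LINT y|\<mu>. \<bar>f y * indicator (B \<epsilon>) y\<bar>)"
      unfolding cell_integral_def by (rule integral_abs_bound)
    then show "\<bar>cell_integral f \<epsilon>\<bar> \<le> 1 * cell_integral (\<lambda>x. \<bar>f x\<bar>) \<epsilon>"
      by (simp add: cell_integral_def abs_mult)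
  qed
  also have "\<dots> = (LINT x|\<mu>. \<bar>f x\<bar>)"
    using f by (subst sum_cell_integral) auto
  finally show ?thesis .
qed

definition cell_limit :: "('a \<Rightarrow> real) \<Rightarrow> bool" where
  "cell_limit f \<longleftrightarrow> (\<lambda>k. LINT x|\<mu>. \<bar>cell_avg k f x - f x\<bar>) \<longlonglongrightarrow> 0"

text \<open>An e / 3 argument: the contraction property bounds the averages of f - g uniformly in
  the level.\<close>

lemma cell_limit_approx:
  assumes f: "integrable \<mu> f"
    and g: "\<And>e. 0 < e \<Longrightarrow> \<exists>g. integrable \<mu> g \<and> cell_limit g \<and> (LINT x|\<mu>. \<bar>f x - g x\<bar>) < e"
  shows "cell_limit f"
  unfolding cell_limit_def
proof (rule LIMSEQ_I)
  fix e :: real assume e: "0 < e"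
  obtain g where gi: "integrable \<mu> g" and gl: "cell_limit g" and fg: "(LINT x|\<mu>. \<bar>f x - g x\<bar>) < e / 3"
    using g[of "e / 3"] e by auto
  from LIMSEQ_D[OF gl[unfolded cell_limit_def], of "e / 3"] e
  obtain k0 where k0: "\<And>k. k0 \<le> k \<Longrightarrow> (LINT x|\<mu>. \<bar>cell_avg k g x - g x\<bar>) < e / 3" by auto
  have "(LINT x|\<mu>. \<bar>cell_avg k f x - f x\<bar>) < e" if k: "k0 \<le> k" for k
  proof -
    have "(LINT x|\<mu>. \<bar>cell_avg k f x - f x\<bar>)
        \<le> (LINT x|\<mu>. \<bar>cell_avg k (\<lambda>x. f x - g x) x\<bar> + \<bar>cell_avg k g x - g x\<bar> + \<bar>f x - g x\<bar>)"
      by (rule integral_mono) (use f gi in \<open>auto simp: cell_avg_diff\<close>)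
    also have "\<dots> = (LINT x|\<mu>. \<bar>cell_avg k (\<lambda>x. f x - g x) x\<bar>) + (LINT x|\<mu>. \<bar>cell_avg k g x - g x\<bar>) + (LINT x|\<mu>. \<bar>f x - g x\<bar>)"
      using f gi by simp
    also have "\<dots> < e"
      using cell_avg_contraction[of "\<lambda>x. f x - g x" k] k0[OF k] fg f gi by simp
    finally show ?thesis .
  qed
  then show "\<exists>no. \<forall>n\<ge>no. norm ((LINT x|\<mu>. \<bar>cell_avg n f x - f x\<bar>) - 0) < e" by auto
qed

lemma cell_limit_add:
  assumes f: "integrable \<mu> f" "cell_limit f" and g: "integrable \<mu> g" "cell_limit g"
  shows "cell_limit (\<lambda>x. f x + g x)"
  unfolding cell_limit_def
proof (rule tendsto_sandwich[OF _ _ tendsto_const])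
  show "(\<lambda>k. (LINT x|\<mu>. \<bar>cell_avg k f x - f x\<bar>) + (LINT x|\<mu>. \<bar>cell_avg k g x - g x\<bar>)) \<longlonglongrightarrow> 0"
    using tendsto_add[OF f(2)[unfolded cell_limit_def] g(2)[unfolded cell_limit_def]] by simp
  show "\<forall>\<^sub>F k in sequentially. (LINT x|\<mu>. \<bar>cell_avg k (\<lambda>x. f x + g x) x - (f x + g x)\<bar>)
      \<le> (LINT x|\<mu>. \<bar>cell_avg k f x - f x\<bar>) + (LINT x|\<mu>. \<bar>cell_avg k g x - g x\<bar>)"
  proof (rule always_eventually, rule allI)
    fix k
    have "(LINT x|\<mu>. \<bar>cell_avg k (\<lambda>x. f x + g x) x - (f x + g x)\<bar>)
        \<le> (LINT x|\<mu>. \<bar>cell_avg k f x - f x\<bar> + \<bar>cell_avg k g x - g x\<bar>)"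
      by (rule integral_mono) (use f g in \<open>auto simp: cell_avg_add\<close>)
    then show "(LINT x|\<mu>. \<bar>cell_avg k (\<lambda>x. f x + g x) x - (f x + g x)\<bar>)
      \<le> (LINT x|\<mu>. \<bar>cell_avg k f x - f x\<bar>) + (LINT x|\<mu>. \<bar>cell_avg k g x - g x\<bar>)"
      using f g by simp
  qed
qed auto

lemma cell_limit_scale:
  assumes "cell_limit f"
  shows "cell_limit (\<lambda>x. c * f x)"
proof -
  have "\<bar>cell_avg k (\<lambda>x. c * f x) x - c * f x\<bar> = \<bar>c\<bar> * \<bar>cell_avg k f x - f x\<bar>" for k x
    by (simp add: cell_avg_scale abs_mult[symmetric] right_diff_distrib)
  then show ?thesis
    using tendsto_mult_left[OF assms[unfolded cell_limit_def], of "\<bar>c\<bar>"] by (simp add: cell_limit_def)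
qed

lemma cell_limit_L1:
  assumes f: "integrable \<mu> f" and s: "\<And>i. integrable \<mu> (s i)" "\<And>i. cell_limit (s i)"
    and lim: "(\<lambda>i. LINT x|\<mu>. \<bar>s i x - f x\<bar>) \<longlonglongrightarrow> 0"
  shows "cell_limit f"
proof (rule cell_limit_approx[OF f])
  fix e :: real assume "0 < e"
  from order_tendstoD(2)[OF lim this] obtain i where "(LINT x|\<mu>. \<bar>s i x - f x\<bar>) < e"
    by (auto simp: eventually_sequentially)
  then show "\<exists>g. integrable \<mu> g \<and> cell_limit g \<and> (LINT x|\<mu>. \<bar>f x - g x\<bar>) < e"
    using s by (intro exI[of _ "s i"]) (auto simp: abs_minus_commute)
qed

text \<open>From level \<open>length \<epsilon>\<close> on, each cell lies inside
  \<open>B \<epsilon>\<close> or is disjoint from it, so averaging reproduces the indicator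
  exactly.\<close>

lemma cell_limit_cell: "cell_limit (indicator (B \<epsilon>))"
  unfolding cell_limit_def
proof (rule tendsto_eventually, unfold eventually_sequentially, intro exI[of _ "length \<epsilon>"] allI impI)
  fix k assume k: "length \<epsilon> \<le> k"
  have "cell_avg k (indicator (B \<epsilon>)) x = indicator (B \<epsilon>) x" if x: "x \<in> \<X>" for x
  proof -
    let ?\<delta> = "digits B x k"
    have "(LINT y|\<mu>. indicator (B \<epsilon>) y * indicator (B ?\<delta>) y) = (LINT y|\<mu>. indicator (B \<epsilon> \<inter> B ?\<delta>) y :: real)"
      by (simp add: indicator_inter_arith)
    also have "\<dots> = (if x \<in> B \<epsilon> then (1/2) ^ k else 0)"
    proof -
      have d: "x \<in> B ?\<delta>" "length ?\<delta> = k" using digits_cell[OF x] by auto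
      have ci: "B \<epsilon> \<inter> B ?\<delta> = {} \<or> B \<epsilon> \<inter> B ?\<delta> = B ?\<delta>"
        using k d(2) by (intro cell_inter) simp
      show ?thesis
      proof (cases "x \<in> B \<epsilon>")
        case True
        then have "B \<epsilon> \<inter> B ?\<delta> = B ?\<delta>" using ci d(1) by blast
        with True d(2) integral_indicator_cell[of ?\<delta>] show ?thesis by (simp only: if_True)
      next
        case False
        then have "B \<epsilon> \<inter> B ?\<delta> = {}" using ci d(1) by blast
        with False show ?thesis by simp
      qed
    qed
    finally show ?thesis using x by (simp add: cell_avg_eq cell_integral_def power_one_over indicator_def)
  qed
  then show "(LINT x|\<mu>. \<bar>cell_avg k (indicator (B \<epsilon>)) x - indicator (B \<epsilon>) x\<bar>) = 0"
    by (intro integral_eq_zero_AE AE_I2) auto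
qed

text \<open>Dynkin's theorem on the intersection-stable family of cells: complements follow by
  linearity, disjoint unions by dominated convergence of the finite unions.\<close>

lemma cell_limit_set:
  assumes "A \<in> sets \<mu>"
  shows "cell_limit (indicator A)"
proof -
  have sub: "insert {} (range B) \<subseteq> Pow \<X>" using cell_subset by auto
  have one: "cell_limit (\<lambda>x. 1)"
  proof -
    have "cell_avg k (\<lambda>x. 1) x = 1" if "x \<in> \<X>" for k x
      using that integral_indicator_cell[of "digits B x k"]
      by (simp add: cell_avg_eq cell_integral_def digits_cell power_one_over del: integral_indicator)
    then show ?thesis unfolding cell_limit_def
      by (intro tendsto_eventually always_eventually allI integral_eq_zero_AE AE_I2) auto
  qed
  have zero: "cell_limit (\<lambda>x. 0)" using cell_limit_scale[OF one, of 0] by simp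
  have meas: "A \<in> sets \<mu>" if "A \<in> sigma_sets \<X> (insert {} (range B))" for A
    using that sets_mu by simp
  note A = assms[unfolded sets_mu]
  show ?thesis
    using A
  proof (induct rule: sigma_sets_induct_disjoint[OF Int_stable_cells sub, consumes 1, case_names basic empty compl union])
    case (basic A)
    then show ?case using zero by (auto simp: cell_limit_cell)
  next
    case empty
    then show ?case using zero by simp
  next
    case (compl A)
    have [measurable]: "A \<in> sets \<mu>" using compl meas by simp
    have "cell_limit (\<lambda>x. 1 + (-1) * indicator A x)"
      by (intro cell_limit_add one cell_limit_scale compl) (auto simp: less_top[symmetric])
    moreover have "cell_avg k (indicator (\<X> - A)) x = cell_avg k (\<lambda>x. 1 + (-1) * indicator A x) x" for k x
      unfolding cell_avg_def cell_integral_def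
      by (intro sum.cong refl arg_cong2[where f="(*)"] Bochner_Integration.integral_cong) (auto simp: indicator_def)
    moreover have "(LINT x|\<mu>. \<bar>cell_avg k (indicator (\<X> - A)) x - indicator (\<X> - A) x\<bar>) =
        (LINT x|\<mu>. \<bar>cell_avg k (indicator (\<X> - A)) x - (1 + (-1) * indicator A x)\<bar>)" for k
      by (intro Bochner_Integration.integral_cong) (auto simp: indicator_def)
    ultimately show ?case by (simp add: cell_limit_def)
  next
    case (union A)
    have [measurable]: "A i \<in> sets \<mu>" for i using union(2) meas by blast
    have disj: "disjoint_family A" by fact
    show ?case
    proof (rule cell_limit_L1[where s="\<lambda>n. indicator (\<Union>i<n. A i)"])
      show "cell_limit (indicator (\<Union>i<n. A i))" for n
      proof (induction n)
        case (Suc n)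
        have "A n \<inter> A i = {}" if "i < n" for i
          using disjoint_family_onD[OF disj, of n i] that by simp
        then have dn: "A n \<inter> (\<Union>i<n. A i) = {}" by blast
        have "(\<Union>i<Suc n. A i) = (\<Union>i<n. A i) \<union> A n" by (auto simp: less_Suc_eq)
        then have "indicator (\<Union>i<Suc n. A i) = (\<lambda>x. indicator (\<Union>i<n. A i) x + indicator (A n) x :: real)"
          using dn by (simp only: fun_eq_iff) (simp add: indicator_def disjoint_iff)
        moreover have "cell_limit (\<lambda>x. indicator (\<Union>i<n. A i) x + indicator (A n) x)"
          by (rule cell_limit_add[OF _ Suc _ union(3)]) (simp_all add: less_top[symmetric])
        ultimately show ?case by simp
      qed (use zero in \<open>simp add: lessThan_def\<close>)
      have "(\<lambda>n. LINT x|\<mu>. \<bar>indicator (\<Union>i<n. A i) x - indicator (\<Union> (range A)) x\<bar>) \<longlonglongrightarrow> (LINT x|\<mu>. \<bar>indicator (\<Union> (range A)) x - indicator (\<Union> (range A)) x\<bar> :: real)"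
      proof (rule integral_dominated_convergence[where w="\<lambda>_. 1"])
        show "AE x in \<mu>. (\<lambda>n. \<bar>indicator (\<Union>i<n. A i) x - indicator (\<Union> (range A)) x\<bar> :: real) \<longlonglongrightarrow> \<bar>indicator (\<Union> (range A)) x - indicator (\<Union> (range A)) x\<bar>"
          by (intro AE_I2 tendsto_intros LIMSEQ_indicator_UN)
      qed (auto simp: indicator_def)
      then show "(\<lambda>n. LINT x|\<mu>. \<bar>indicator (\<Union>i<n. A i) x - indicator (\<Union> (range A)) x :: real\<bar>) \<longlonglongrightarrow> 0" by simp
    qed (auto simp: less_top[symmetric])
  qed
qed

text \<open>Levy's upward theorem in mean for the filtration of the levels, obtained by
  approximating f with simple functions.\<close>

theorem cell_avg_L1_limit:
  assumes "integrable \<mu> f"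
  shows "(\<lambda>k. LINT x|\<mu>. \<bar>cell_avg k f x - f x\<bar>) \<longlonglongrightarrow> 0"
  unfolding cell_limit_def[symmetric] using assms
proof (induction rule: integrable_induct)
  case (base A c)
  show ?case using cell_limit_scale[OF cell_limit_set[OF base(1)], of c] by (simp add: mult.commute)
next
  case (lim f s)
  show ?case
  proof (rule cell_limit_L1[OF lim(4) lim(1,5)])
    have [measurable]: "f \<in> borel_measurable \<mu>" "\<And>i. s i \<in> borel_measurable \<mu>" using lim(1,4) by auto
    have "(\<lambda>i. LINT x|\<mu>. \<bar>s i x - f x\<bar>) \<longlonglongrightarrow> (LINT x|\<mu>. \<bar>f x - f x\<bar>)"
    \<comment> \<open>The simple functions satisfy |s i| \<le> 2 |f|, whence the factor 3.\<close>
    proof (rule integral_dominated_convergence[where w="\<lambda>x. 3 * \<bar>f x\<bar>"])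
      show "AE x in \<mu>. (\<lambda>i. \<bar>s i x - f x\<bar>) \<longlonglongrightarrow> \<bar>f x - f x\<bar>"
        using lim(2) by (intro AE_I2 tendsto_intros) auto
      show "AE x in \<mu>. norm \<bar>s i x - f x\<bar> \<le> 3 * \<bar>f x\<bar>" for i
      proof (rule AE_I2)
        fix x assume "x \<in> space \<mu>"
        from lim(3)[OF this, of i] show "norm \<bar>s i x - f x\<bar> \<le> 3 * \<bar>f x\<bar>" by simp
      qed
    qed (use lim(4) in auto)
    then show "(\<lambda>i. LINT x|\<mu>. \<bar>s i x - f x\<bar>) \<longlonglongrightarrow> 0" by simp
  qed
qed (auto intro: cell_limit_add)

section \<open>Relative entropy along the tree\<close>

definition split_entropy :: "('a \<Rightarrow> real) \<Rightarrow> bool list \<Rightarrow> real" where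
  "split_entropy f \<sigma> = (\<Sum>b\<in>UNIV. cell_integral f (\<sigma> @ [b]) * ln (2 * cell_integral f (\<sigma> @ [b]) / cell_integral f \<sigma>))"

lemma cell_integral_split:
  "integrable \<mu> f \<Longrightarrow> cell_integral f (\<sigma> @ [False]) + cell_integral f (\<sigma> @ [True]) = cell_integral f \<sigma>"
  unfolding cell_integral_def
  by (subst Bochner_Integration.integral_add[symmetric])
    (auto intro!: integrable_cell simp: distrib_left[symmetric] indicator_cell_split)

text \<open>Gibbs' inequality: \<open>split_entropy\<close> is the mass of the cell times the
  relative entropy of its split with respect to the fair one.\<close>

lemma split_entropy_nonneg:
  assumes f: "integrable \<mu> f" and pos: "\<And>\<epsilon>. 0 < cell_integral f \<epsilon>"
  shows "0 \<le> split_entropy f \<sigma>"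
proof -
  let ?p = "cell_integral f"
  have "?p (\<sigma> @ [b]) - ?p \<sigma> / 2 \<le> ?p (\<sigma> @ [b]) * ln (2 * ?p (\<sigma> @ [b]) / ?p \<sigma>)" for b
  proof -
    have "ln (?p \<sigma> / (2 * ?p (\<sigma> @ [b]))) \<le> ?p \<sigma> / (2 * ?p (\<sigma> @ [b])) - 1"
      using pos by (intro ln_le_minus_one) (simp add: divide_pos_pos)
    moreover have "ln (?p \<sigma> / (2 * ?p (\<sigma> @ [b]))) = - ln (2 * ?p (\<sigma> @ [b]) / ?p \<sigma>)"
      using pos[of \<sigma>] pos[of "\<sigma> @ [b]"] by (simp add: ln_div)
    ultimately have "1 - ?p \<sigma> / (2 * ?p (\<sigma> @ [b])) \<le> ln (2 * ?p (\<sigma> @ [b]) / ?p \<sigma>)" by simp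
    from mult_left_mono[OF this, of "?p (\<sigma> @ [b])"] pos[of "\<sigma> @ [b]"] show ?thesis
      by (simp add: algebra_simps)
  qed
  from this[of False] this[of True] cell_integral_split[OF f, of \<sigma>]
  show ?thesis by (simp add: split_entropy_def UNIV_bool)
qed

text \<open>The chain rule of relative entropy: the density of a child cell is the doubled splitting
  ratio times the density of its parent, so the logarithms telescope.\<close>

lemma sum_split_entropy:
  assumes f: "integrable \<mu> f" and pos: "\<And>\<epsilon>. 0 < cell_integral f \<epsilon>" and one: "cell_integral f [] = 1"
  shows "(\<Sum>k<K. \<Sum>\<sigma>\<in>words k. split_entropy f \<sigma>) =
    (\<Sum>\<epsilon>\<in>words K. cell_integral f \<epsilon> * ln (2 ^ K * cell_integral f \<epsilon>))"
proof (induction K)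
  case 0
  then show ?case by (simp add: words_0 one)
next
  case (Suc K)
  let ?p = "cell_integral f"
  have "(\<Sum>\<epsilon>\<in>words (Suc K). ?p \<epsilon> * ln (2 ^ Suc K * ?p \<epsilon>)) =
    (\<Sum>\<sigma>\<in>words K. split_entropy f \<sigma> + ?p \<sigma> * ln (2 ^ K * ?p \<sigma>))"
  proof (subst sum_words_Suc, rule sum.cong)
    fix \<sigma> :: "bool list"
    have l: "ln (2 ^ Suc K * ?p (\<sigma> @ [b])) = ln (2 * ?p (\<sigma> @ [b]) / ?p \<sigma>) + ln (2 ^ K * ?p \<sigma>)" for b
      using pos[of \<sigma>] pos[of "\<sigma> @ [b]"] by (simp add: ln_mult ln_div)
    have "?p \<sigma> * ln (2 ^ K * ?p \<sigma>) = ?p (\<sigma> @ [False]) * ln (2 ^ K * ?p \<sigma>) + ?p (\<sigma> @ [True]) * ln (2 ^ K * ?p \<sigma>)"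
      using cell_integral_split[OF f, of \<sigma>] by (metis distrib_right)
    then show "?p (\<sigma> @ [False]) * ln (2 ^ Suc K * ?p (\<sigma> @ [False])) + ?p (\<sigma> @ [True]) * ln (2 ^ Suc K * ?p (\<sigma> @ [True]))
      = split_entropy f \<sigma> + ?p \<sigma> * ln (2 ^ K * ?p \<sigma>)"
      unfolding l split_entropy_def UNIV_bool by (simp add: distrib_left)
  qed simp
  with Suc show ?case by (simp add: sum.distrib)
qed

theorem split_entropy_sums:
  assumes f: "integrable \<mu> f" and pos: "\<And>\<epsilon>. 0 < cell_integral f \<epsilon>" and one: "cell_integral f [] = 1"
    and nn: "\<And>x. x \<in> \<X> \<Longrightarrow> 0 \<le> f x" and fin: "integrable \<mu> (\<lambda>x. f x * ln (f x))"
  shows "(\<lambda>k. \<Sum>\<sigma>\<in>words k. split_entropy f \<sigma>) sums (LINT x|\<mu>. f x * ln (f x))"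
proof -
  let ?D = "\<lambda>k. \<Sum>\<sigma>\<in>words k. split_entropy f \<sigma>"
  define S where "S K = (\<Sum>k<K. ?D k)" for K
  have D: "0 \<le> ?D k" for k by (intro sum_nonneg split_entropy_nonneg f pos)
  have S: "S K = (\<Sum>\<epsilon>\<in>words K. cell_integral f \<epsilon> * ln (2 ^ K * cell_integral f \<epsilon>))" for K
    unfolding S_def by (rule sum_split_entropy[OF f pos one])
  \<comment> \<open>The same sum in two forms: the logarithm of the average integrated against f
    itself serves the upper bound, integrated against the average (\<open>S2\<close>) it serves
    Fatou's lemma.\<close>
  have S1: "S K = (LINT x|\<mu>. ln (cell_avg K f x) * f x)" and S1i: "integrable \<mu> (\<lambda>x. ln (cell_avg K f x) * f x)" for K
  proof -
    have "S K = (LINT x|\<mu>. ln (2 ^ K * cell_integral f (digits B x K)) * f x)"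
      unfolding S by (subst sum_cell_integral[OF f, symmetric]) (simp add: mult.commute)
    also have "\<dots> = (LINT x|\<mu>. ln (cell_avg K f x) * f x)"
      by (rule Bochner_Integration.integral_cong) (auto simp: cell_avg_eq)
    finally show "S K = (LINT x|\<mu>. ln (cell_avg K f x) * f x)" .
    have "integrable \<mu> (\<lambda>x. ln (2 ^ K * cell_integral f (digits B x K)) * f x)"
      by (rule integrable_digits[OF f])
    then show "integrable \<mu> (\<lambda>x. ln (cell_avg K f x) * f x)"
      by (rule Bochner_Integration.integrable_cong[THEN iffD1, rotated 2]) (auto simp: cell_avg_eq)
  qed
  have S2: "S K = (LINT x|\<mu>. cell_avg K f x * ln (cell_avg K f x))" for K
    unfolding S by (subst integral_comp_cell_avg[of "\<lambda>t. t * ln t"]) (simp add: power_one_over)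
  have upper: "S K \<le> (LINT x|\<mu>. f x * ln (f x))" for K
  proof -
    have avg: "(LINT x|\<mu>. cell_avg K f x) = (LINT x|\<mu>. f x)"
      using sum_cell_integral[OF f, of "\<lambda>_. 1" K] integral_comp_cell_avg[of "\<lambda>x. x" K f] by (simp add: power_one_over)
    \<comment> \<open>The added difference of average and f has integral 0; it makes Gibbs'
      inequality hold pointwise.\<close>
    have "S K \<le> (LINT x|\<mu>. f x * ln (f x) + cell_avg K f x - f x)"
      unfolding S1
    proof (rule integral_mono)
      fix x assume "x \<in> space \<mu>"
      then have x: "x \<in> \<X>" by simp
      have a: "0 < cell_avg K f x" using pos by (simp add: cell_avg_eq x)
      show "ln (cell_avg K f x) * f x \<le> f x * ln (f x) + cell_avg K f x - f x"
      proof (cases "f x = 0")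
        case False
        then have f0: "0 < f x" using nn[OF x] by simp
        have "ln (cell_avg K f x) - ln (f x) = ln (cell_avg K f x / f x)" using a f0 by (simp add: ln_div)
        also have "\<dots> \<le> cell_avg K f x / f x - 1" using a f0 by (intro ln_le_minus_one) auto
        finally have "f x * (ln (cell_avg K f x) - ln (f x)) \<le> f x * (cell_avg K f x / f x - 1)"
          using f0 by (intro mult_left_mono) auto
        then show ?thesis using f0 by (simp add: algebra_simps)
      qed (use a in simp)
    qed (use S1i f fin in auto)
    also have "\<dots> = (LINT x|\<mu>. f x * ln (f x))" using f fin avg by simp
    finally show ?thesis .
  qed
  have inc: "incseq S" unfolding S_def by (intro incseq_SucI) (use D in simp)
  have "bdd_above (range S)" by (rule bdd_aboveI2[OF upper])
  from LIMSEQ_incseq_SUP[OF this inc] obtain l where l: "S \<longlonglongrightarrow> l" by blast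
  have "l \<le> (LINT x|\<mu>. f x * ln (f x))"
    using LIMSEQ_le_const2[OF l] upper by blast
  moreover have "(LINT x|\<mu>. f x * ln (f x)) \<le> l"
  proof -
    \<comment> \<open>Adding 1 makes the integrands nonnegative, as Fatou's lemma needs.\<close>
    have ge: "0 \<le> t * ln t + 1" if "0 \<le> t" for t :: real
    proof (cases "t = 0")
      case False
      then have t: "0 < t" using that by simp
      have "ln (1 / t) \<le> 1 / t - 1" using t by (intro ln_le_minus_one) auto
      then have "t * (1 - 1 / t) \<le> t * ln t" using t by (intro mult_left_mono) (auto simp: ln_div)
      then show ?thesis using t by (simp add: algebra_simps)
    qed simp
    have [measurable]: "f \<in> borel_measurable \<mu>" using f by auto
    \<comment> \<open>A subsequence suffices, since the whole sequence \<open>S\<close> already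
      converges to \<open>l\<close>.\<close>
    from tendsto_L1_AE_subseq[of \<mu> "\<lambda>k x. cell_avg k f x - f x"] cell_avg_L1_limit[OF f] f
    obtain r :: "nat \<Rightarrow> nat" where r: "strict_mono r" and ae: "AE x in \<mu>. (\<lambda>n. cell_avg (r n) f x - f x) \<longlonglongrightarrow> 0" by auto
    have [measurable]: "cell_avg k f \<in> borel_measurable \<mu>" for k using integrable_cell_avg by blast
    define h where "h n x = cell_avg (r n) f x * ln (cell_avg (r n) f x) + 1" for n x
    have h: "(\<integral>\<^sup>+x. ennreal (h n x) \<partial>\<mu>) = ennreal (S (r n) + 1)" for n
    proof -
      have "integrable \<mu> (\<lambda>x. cell_avg (r n) f x * ln (cell_avg (r n) f x))"
        by (rule integrable_comp_cell_avg[of "\<lambda>t. t * ln t"])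
      then show ?thesis
        unfolding h_def S2 using pos
        by (subst nn_integral_eq_integral)
          (auto intro!: ge simp: cell_avg_eq less_imp_le mu.prob_space[simplified])
    qed
    have "ennreal ((LINT x|\<mu>. f x * ln (f x)) + 1) = (\<integral>\<^sup>+x. ennreal (f x * ln (f x) + 1) \<partial>\<mu>)"
      using fin by (subst nn_integral_eq_integral) (auto intro!: ge nn simp: mu.prob_space[simplified])
    also have "\<dots> \<le> (\<integral>\<^sup>+x. liminf (\<lambda>n. ennreal (h n x)) \<partial>\<mu>)"
    proof (rule nn_integral_mono_AE)
      show "AE x in \<mu>. ennreal (f x * ln (f x) + 1) \<le> liminf (\<lambda>n. ennreal (h n x))"
        using ae AE_space
      proof eventually_elim
        case (elim x)
        then have lim: "(\<lambda>n. cell_avg (r n) f x) \<longlonglongrightarrow> f x" using Lim_null by blast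
        have x: "x \<in> \<X>" using elim by simp
        show ?case
        proof (cases "f x = 0")
          case False
          then have "(\<lambda>n. h n x) \<longlonglongrightarrow> f x * ln (f x) + 1"
            unfolding h_def by (intro tendsto_intros lim) auto
          then have "(\<lambda>n. ennreal (h n x)) \<longlonglongrightarrow> ennreal (f x * ln (f x) + 1)" by (rule tendsto_ennrealI)
          then have "liminf (\<lambda>n. ennreal (h n x)) = ennreal (f x * ln (f x) + 1)" by (intro lim_imp_Liminf) simp_all
          then show ?thesis by simp
        next
          case True
          \<comment> \<open>The logarithm is discontinuous at 0, but the averages are positive and t
            ln t tends to 0 from the right.\<close>
          have pa: "0 < cell_avg (r n) f x" for n using pos by (simp add: cell_avg_eq x)
          have "cell_avg (r n) f x \<in> {0<..} \<and> cell_avg (r n) f x \<noteq> 0" for n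
            using pa[of n] by auto
          with lim True have lim0: "filterlim (\<lambda>n. cell_avg (r n) f x) (at_right 0) sequentially"
            unfolding filterlim_at by simp
          have "((\<lambda>t. t * ln t + 1) \<longlongrightarrow> (1::real)) (at_right 0)"
            by real_asymp
          from filterlim_compose[OF this lim0] have "(\<lambda>n. ennreal (h n x)) \<longlonglongrightarrow> ennreal 1"
            unfolding h_def by (rule tendsto_ennrealI)
          then have "liminf (\<lambda>n. ennreal (h n x)) = ennreal 1" by (intro lim_imp_Liminf) simp_all
          then show ?thesis using True by simp
        qed
      qed
    qed
    also have "\<dots> \<le> liminf (\<lambda>n. \<integral>\<^sup>+x. ennreal (h n x) \<partial>\<mu>)"
      by (rule nn_integral_liminf) (simp add: h_def)
    also have "\<dots> = liminf (\<lambda>n. ennreal (S (r n) + 1))" by (simp add: h)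
    also have "\<dots> = ennreal (l + 1)"
    proof (rule lim_imp_Liminf)
      have "(\<lambda>n. S (r n)) \<longlonglongrightarrow> l" using LIMSEQ_subseq_LIMSEQ[OF l r] by (simp add: comp_def)
      then show "(\<lambda>n. ennreal (S (r n) + 1)) \<longlonglongrightarrow> ennreal (l + 1)" by (intro tendsto_ennrealI tendsto_intros)
    qed simp
    finally have "ennreal ((LINT x|\<mu>. f x * ln (f x)) + 1) \<le> ennreal (l + 1)" .
    \<comment> \<open>\<open>ennreal\<close> truncates negative reals to 0, so the comparison is
      reversible only with the sign known.\<close>
    moreover have "0 \<le> l"
    proof (rule LIMSEQ_le_const[OF l])
      show "\<exists>N. \<forall>n\<ge>N. 0 \<le> S n" by (auto simp: S_def intro!: sum_nonneg split_entropy_nonneg f pos)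
    qed
    ultimately show ?thesis by (subst (asm) ennreal_le_iff) auto
  qed
  ultimately show ?thesis using l by (simp add: sums_def S_def[abs_def])
qed

end

section \<open>Cell counts of an independent sample\<close>

lemma (in cell_tree) node_sum_eq_mean_split:
  "node_sum a N \<sigma> = mean_split (a (Suc (length \<sigma>))) (N (\<sigma> @ [False])) (N (\<sigma> @ [True]))"
  by (simp add: node_sum_def mean_split_def UNIV_bool)

locale iid_sample = dyadic_tree \<X> B + M: prob_space M
  for \<X> :: "'a::euclidean_space set" and B and M :: "'w measure" +
  fixes Z :: "nat \<Rightarrow> 'w \<Rightarrow> 'a" and f :: "'a \<Rightarrow> real"
  assumes indep: "M.indep_vars (\<lambda>_. restrict_space lborel \<X>) Z UNIV"
    and dist: "distributed M (restrict_space lborel \<X>) (Z i) (\<lambda>t. ennreal (f t))"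
    and f_integrable: "integrable (restrict_space lborel \<X>) f"
    and f_nonneg: "x \<in> \<X> \<Longrightarrow> 0 \<le> f x"
    and f_pos: "0 < cell_integral f \<epsilon>"
    and f_one: "cell_integral f [] = 1"
begin

abbreviation p :: "bool list \<Rightarrow> real" where "p \<equiv> cell_integral f"
abbreviation count :: "nat \<Rightarrow> 'w \<Rightarrow> bool list \<Rightarrow> real" where
  "count n \<omega> \<equiv> sample_count B n (\<lambda>i. Z i \<omega>)"

lemma Z_measurable [measurable]: "Z i \<in> measurable M \<mu>"
  using distributed_measurable[OF dist] .

lemma Z_space: "\<omega> \<in> space M \<Longrightarrow> Z i \<omega> \<in> \<X>"
  using measurable_space[OF Z_measurable] by simp

lemma p_split: "p (\<sigma> @ [False]) + p (\<sigma> @ [True]) = p \<sigma>"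
  by (rule cell_integral_split[OF f_integrable])

lemma p_le_1: "p \<epsilon> \<le> 1"
proof (induction \<epsilon> rule: rev_induct)
  case (snoc b \<epsilon>)
  then show ?case using p_split[of \<epsilon>] f_pos[of "\<epsilon> @ [False]"] f_pos[of "\<epsilon> @ [True]"] by (cases b) auto
qed (simp add: f_one[unfolded cell_Nil])

lemma indicator_Z_measurable [measurable]: "(\<lambda>\<omega>. indicator (B \<epsilon>) (Z i \<omega>) :: real) \<in> borel_measurable M"
proof -
  have "(indicator (B \<epsilon>) :: 'a \<Rightarrow> real) \<in> borel_measurable \<mu>" by simp
  then show ?thesis by (rule measurable_compose[OF Z_measurable])
qed

lemma integrable_indicator_Z [simp]: "integrable M (\<lambda>\<omega>. indicator (B \<epsilon>) (Z i \<omega>) :: real)"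
  by (rule M.integrable_const_bound[where B=1]) (auto simp: indicator_def)

lemma expectation_indicator_Z: "M.expectation (\<lambda>\<omega>. indicator (B \<epsilon>) (Z i \<omega>)) = p \<epsilon>"
  using distributed_integral[OF dist, of "indicator (B \<epsilon>)" i] f_nonneg by (simp add: cell_integral_def)

lemma count_measurable [measurable]: "(\<lambda>\<omega>. count n \<omega> \<epsilon>) \<in> borel_measurable M"
  unfolding sample_count_def by measurable

lemma integrable_count [simp]: "integrable M (\<lambda>\<omega>. count n \<omega> \<epsilon>)"
  unfolding sample_count_def by simp

lemma expectation_count: "M.expectation (\<lambda>\<omega>. count n \<omega> \<epsilon>) = n * p \<epsilon>"
  unfolding sample_count_def by (simp add: Bochner_Integration.integral_sum expectation_indicator_Z)

lemma integrable_count_square [simp]: "integrable M (\<lambda>\<omega>. (count n \<omega> \<epsilon>)\<^sup>2)"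
  by (rule M.integrable_const_bound[where B="(real n)\<^sup>2"])
    (auto intro!: power_mono sample_count_le sample_count_nonneg)

text \<open>Independence factors the off-diagonal pairs; on the diagonal the indicator is idempotent
  and contributes its mean p.\<close>

lemma expectation_count_square: "M.expectation (\<lambda>\<omega>. (count n \<omega> \<epsilon>)\<^sup>2) \<le> n * p \<epsilon> + (n * p \<epsilon>)\<^sup>2"
proof -
  define I where "I i \<omega> = (indicator (B \<epsilon>) (Z i \<omega>) :: real)" for i \<omega>
  have ind: "M.indep_vars (\<lambda>_. borel) I UNIV"
    unfolding I_def by (rule M.indep_vars_compose2[OF indep]) simp
  have pair: "M.expectation (\<lambda>\<omega>. I i \<omega> * I j \<omega>) \<le> (if i = j then p \<epsilon> else 0) + (p \<epsilon>)\<^sup>2" for i j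
  proof (cases "i = j")
    case True
    then have "M.expectation (\<lambda>\<omega>. I i \<omega> * I j \<omega>) = M.expectation (\<lambda>\<omega>. indicator (B \<epsilon>) (Z j \<omega>))"
      by (intro Bochner_Integration.integral_cong) (auto simp: I_def indicator_def)
    then show ?thesis using True by (simp only: expectation_indicator_Z) simp
  next
    case False
    have "M.expectation (\<lambda>\<omega>. \<Prod>k\<in>{i, j}. I k \<omega>) = (\<Prod>k\<in>{i, j}. M.expectation (I k))"
      by (rule M.indep_vars_lebesgue_integral) (auto simp: I_def intro: M.indep_vars_subset[OF ind[unfolded I_def]])
    then show ?thesis using False expectation_indicator_Z[of \<epsilon>] by (simp add: I_def[abs_def] power2_eq_square)
  qed
  have int: "integrable M (\<lambda>\<omega>. I i \<omega> * I j \<omega>)" for i j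
    unfolding I_def by (rule M.integrable_const_bound[where B=1]) (auto simp: indicator_def)
  have "M.expectation (\<lambda>\<omega>. (count n \<omega> \<epsilon>)\<^sup>2) = M.expectation (\<lambda>\<omega>. \<Sum>i<n. \<Sum>j<n. I i \<omega> * I j \<omega>)"
    by (simp add: sample_count_def I_def power2_eq_square sum_product)
  also have "\<dots> = (\<Sum>i<n. \<Sum>j<n. M.expectation (\<lambda>\<omega>. I i \<omega> * I j \<omega>))"
    using int by (simp add: Bochner_Integration.integral_sum)
  also have "\<dots> \<le> (\<Sum>i<n. \<Sum>j<n. (if i = j then p \<epsilon> else 0) + (p \<epsilon>)\<^sup>2)"
    by (intro sum_mono pair)
  also have "\<dots> = n * p \<epsilon> + (n * p \<epsilon>)\<^sup>2"
    by (simp add: sum.distrib power2_eq_square algebra_simps)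
  finally show ?thesis .
qed

lemma count_frequency_variance:
  assumes "0 < n"
  shows "M.expectation (\<lambda>\<omega>. (count n \<omega> \<epsilon> / n - p \<epsilon>)\<^sup>2) \<le> 1 / n"
proof -
  have "M.expectation (\<lambda>\<omega>. (count n \<omega> \<epsilon> / n - p \<epsilon>)\<^sup>2)
      = M.expectation (\<lambda>\<omega>. (count n \<omega> \<epsilon>)\<^sup>2 / (real n)\<^sup>2 - 2 * p \<epsilon> / n * count n \<omega> \<epsilon> + (p \<epsilon>)\<^sup>2)"
    by (simp add: power2_diff power_divide mult_ac)
  also have "\<dots> = M.expectation (\<lambda>\<omega>. (count n \<omega> \<epsilon>)\<^sup>2) / (real n)\<^sup>2 - 2 * p \<epsilon> / n * (n * p \<epsilon>) + (p \<epsilon>)\<^sup>2"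
    by (simp add: expectation_count M.prob_space)
  also have "\<dots> \<le> (n * p \<epsilon> + (n * p \<epsilon>)\<^sup>2) / (real n)\<^sup>2 - 2 * p \<epsilon> / n * (n * p \<epsilon>) + (p \<epsilon>)\<^sup>2"
    by (intro add_right_mono diff_right_mono divide_right_mono expectation_count_square) simp
  also have "\<dots> = p \<epsilon> / n"
    using assms by (simp add: field_simps power2_eq_square)
  also have "\<dots> \<le> 1 / n" using p_le_1 by (simp add: divide_right_mono)
  finally show ?thesis .
qed

text \<open>Counts are natural numbers, so every function of them is measurable and no regularity of
  \<open>beta_log_mean\<close> has to be established.\<close>

lemma measurable_count_comp [measurable]:
  "(\<lambda>\<omega>. h (count n \<omega> \<epsilon>) (count n \<omega> \<delta>) :: real) \<in> borel_measurable M"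
proof -
  define c where "c \<epsilon> \<omega> = card {i. i < n \<and> Z i \<omega> \<in> B \<epsilon>}" for \<epsilon> \<omega>
  have c: "count n \<omega> \<epsilon> = real (c \<epsilon> \<omega>)" for \<epsilon> \<omega>
  proof -
    have "{..<n} \<inter> {i. Z i \<omega> \<in> B \<epsilon>} = {i. i < n \<and> Z i \<omega> \<in> B \<epsilon>}" by auto
    then show ?thesis
      by (simp add: sample_count_def c_def indicator_def sum.If_cases)
  qed
  have [measurable]: "c \<epsilon> \<in> measurable M (count_space UNIV)" for \<epsilon>
  proof -
    have "(\<lambda>\<omega>. nat \<lfloor>count n \<omega> \<epsilon>\<rfloor>) \<in> measurable M (count_space UNIV)" by measurable
    then show ?thesis by (simp add: c)
  qed
  have "(\<lambda>\<omega>. h (real (c \<epsilon> \<omega>)) (real (c \<delta> \<omega>))) \<in> borel_measurable M"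
    by measurable
  then show ?thesis by (simp add: c)
qed

section \<open>Mean convergence of the contribution of one cell\<close>

definition node_mean :: "(nat \<Rightarrow> real) \<Rightarrow> nat \<Rightarrow> bool list \<Rightarrow> 'w \<Rightarrow> real" where
  "node_mean a n \<sigma> \<omega> = node_sum a (count n \<omega>) \<sigma> / n"

lemma node_mean_measurable [measurable]: "node_mean a n \<sigma> \<in> borel_measurable M"
  unfolding node_mean_def node_sum_eq_mean_split by (rule measurable_count_comp)

lemma split_entropy_eq: "split_entropy f \<sigma> =
    p (\<sigma> @ [False]) * ln (2 * p (\<sigma> @ [False]) / p \<sigma>) + p (\<sigma> @ [True]) * ln (2 * p (\<sigma> @ [True]) / p \<sigma>)"
  by (simp add: split_entropy_def UNIV_bool)

context
  fixes a :: "nat \<Rightarrow> real" and \<sigma> :: "bool list"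
  assumes A4: "4 \<le> a (Suc (length \<sigma>))"
begin

abbreviation "A \<equiv> a (Suc (length \<sigma>))"
abbreviation "u n \<omega> \<equiv> count n \<omega> (\<sigma> @ [False])"
abbreviation "v n \<omega> \<equiv> count n \<omega> (\<sigma> @ [True])"

lemma count_sum_le: "u n \<omega> + v n \<omega> \<le> n"
  using sample_count_child[of n "\<lambda>i. Z i \<omega>" \<sigma>] sample_count_le[of B n _ \<sigma>] by simp

lemma count_nn: "0 \<le> count n \<omega> \<epsilon>"
  by (rule sample_count_nonneg)

lemma log_split_count_bounds:
  assumes n: "0 < n"
  shows "0 \<le> log_split A (u n \<omega>) (v n \<omega>) / n" "log_split A (u n \<omega>) (v n \<omega>) / n \<le> ln 2"
    "log_split A (u n \<omega>) (v n \<omega>) / n \<le> n / (2 * A)"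
proof -
  have A: "0 < A" using A4 by simp
  show "0 \<le> log_split A (u n \<omega>) (v n \<omega>) / n"
    using log_split_nonneg[OF A count_nn count_nn] by simp
  have "log_split A (u n \<omega>) (v n \<omega>) \<le> (u n \<omega> + v n \<omega>) * ln 2"
    by (rule log_split_le_ln2[OF A count_nn count_nn])
  also have "\<dots> \<le> n * ln 2" by (intro mult_right_mono count_sum_le) simp
  finally show "log_split A (u n \<omega>) (v n \<omega>) / n \<le> ln 2" using n by (simp add: divide_le_eq mult.commute)
  have "log_split A (u n \<omega>) (v n \<omega>) \<le> (u n \<omega> + v n \<omega>)\<^sup>2 / (2 * A)"
    by (rule log_split_le_square[OF A count_nn count_nn])
  also have "\<dots> \<le> (real n)\<^sup>2 / (2 * A)"
    using A by (intro divide_right_mono power_mono count_sum_le add_nonneg_nonneg count_nn) simp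
  finally have "log_split A (u n \<omega>) (v n \<omega>) / n \<le> (real n)\<^sup>2 / (2 * A) / n"
    by (rule divide_right_mono) simp
  also have "\<dots> = n / (2 * A)" using n by (simp add: power2_eq_square)
  finally show "log_split A (u n \<omega>) (v n \<omega>) / n \<le> n / (2 * A)" .
qed

lemma node_mean_bounds:
  assumes n: "0 < n"
  shows "node_mean a n \<sigma> \<omega> \<le> log_split A (u n \<omega>) (v n \<omega>) / n"
    and "log_split A (u n \<omega>) (v n \<omega>) / n \<le> node_mean a n \<sigma> \<omega> + 2 / A"
    and "log_split A (u n \<omega>) (v n \<omega>) / n \<le> node_mean a n \<sigma> \<omega> + 4 / n"
proof -
  have A: "2 \<le> A" using A4 by simp
  show "node_mean a n \<sigma> \<omega> \<le> log_split A (u n \<omega>) (v n \<omega>) / n"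
    unfolding node_mean_def node_sum_eq_mean_split
    by (intro divide_right_mono mean_split_le_log_split A count_nn) simp
  have "log_split A (u n \<omega>) (v n \<omega>) \<le> mean_split A (u n \<omega>) (v n \<omega>) + 2 * (u n \<omega> + v n \<omega>) / A"
    by (intro log_split_le_mean_split A count_nn)
  also have "2 * (u n \<omega> + v n \<omega>) / A \<le> 2 * n / A"
    using A count_sum_le[of n \<omega>] by (intro divide_right_mono mult_left_mono) auto
  finally have "log_split A (u n \<omega>) (v n \<omega>) / n \<le> (mean_split A (u n \<omega>) (v n \<omega>) + 2 * n / A) / n"
    by (intro divide_right_mono) auto
  then show "log_split A (u n \<omega>) (v n \<omega>) / n \<le> node_mean a n \<sigma> \<omega> + 2 / A"
    using n by (simp add: node_mean_def node_sum_eq_mean_split add_divide_distrib)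
  have "log_split A (u n \<omega>) (v n \<omega>) / n \<le> (mean_split A (u n \<omega>) (v n \<omega>) + 4) / n"
    by (intro divide_right_mono log_split_le_mean_split A count_nn) simp
  then show "log_split A (u n \<omega>) (v n \<omega>) / n \<le> node_mean a n \<sigma> \<omega> + 4 / n"
    by (simp add: node_mean_def node_sum_eq_mean_split add_divide_distrib)
qed

text \<open>\<open>node_mean\<close> lies within 2 / A below a nonnegative quantity, so bounding
  that quantity from above controls both signs.\<close>

lemma node_mean_abs_le: "0 < n \<Longrightarrow> \<bar>node_mean a n \<sigma> \<omega>\<bar> \<le> log_split A (u n \<omega>) (v n \<omega>) / n + 2 / A"
  using node_mean_bounds[of n \<omega>] log_split_count_bounds(1)[of n \<omega>] A4 divide_nonneg_nonneg[of 2 A] by linarith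

lemma node_mean_abs_le_const: "0 < n \<Longrightarrow> \<bar>node_mean a n \<sigma> \<omega>\<bar> \<le> ln 2 + 2 / A"
  using node_mean_abs_le[of n \<omega>] log_split_count_bounds(2)[of n \<omega>] by linarith

lemma integrable_node_mean: "0 < n \<Longrightarrow> integrable M (node_mean a n \<sigma>)"
  by (rule M.integrable_const_bound[where B="ln 2 + 2 / A"]) (auto intro: node_mean_abs_le_const)

lemma integrable_log_split: "integrable M (\<lambda>\<omega>. log_split A (u n \<omega>) (v n \<omega>) / n)" if n: "0 < n"
proof (rule M.integrable_const_bound[where B="ln 2"])
  have "\<bar>log_split A (u n \<omega>) (v n \<omega>) / n\<bar> \<le> ln 2" for \<omega>
    using log_split_count_bounds(1,2)[OF n] by (subst abs_of_nonneg) auto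
  then show "AE \<omega> in M. norm (log_split A (u n \<omega>) (v n \<omega>) / n) \<le> ln 2"
    by (intro AE_I2) (simp only: real_norm_def)
qed measurable

text \<open>\<open>log_split_le_weights\<close> with m = n involves the counts only through first
  and second moments. The first moments give \<open>split_entropy\<close> exactly, and what remains
  after cancellation is 2 / n.\<close>

lemma expectation_log_split_le:
  assumes n: "0 < n"
  shows "M.expectation (\<lambda>\<omega>. log_split A (u n \<omega>) (v n \<omega>) / n) \<le> split_entropy f \<sigma> + 1 / sqrt A"
proof -
  have A: "0 < A" using A4 by simp
  have n': "0 < real n" using n by simp
  let ?p = "p (\<sigma> @ [False])" and ?q = "p (\<sigma> @ [True])"
  note pq = f_pos[of "\<sigma> @ [False]"] f_pos[of "\<sigma> @ [True]"]
  have "M.expectation (\<lambda>\<omega>. log_split A (u n \<omega>) (v n \<omega>) / n)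
    \<le> M.expectation (\<lambda>\<omega>. (u n \<omega> * ln (2 * ?p / p \<sigma>) + v n \<omega> * ln (2 * ?q / p \<sigma>)
    + (u n \<omega>)\<^sup>2 / (n * ?p) + (v n \<omega>)\<^sup>2 / (n * ?q) - 2 * (u n \<omega> + v n \<omega>) + n * p \<sigma>) / n)"
  proof (rule integral_mono)
    fix \<omega>
    show "log_split A (u n \<omega>) (v n \<omega>) / n \<le> (u n \<omega> * ln (2 * ?p / p \<sigma>) + v n \<omega> * ln (2 * ?q / p \<sigma>)
      + (u n \<omega>)\<^sup>2 / (n * ?p) + (v n \<omega>)\<^sup>2 / (n * ?q) - 2 * (u n \<omega> + v n \<omega>) + n * p \<sigma>) / n"
      using log_split_le_weights[OF A count_nn count_nn n' pq, of n \<omega> _ n \<omega>]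
      by (intro divide_right_mono) (simp_all add: p_split)
  qed (use integrable_log_split[OF n] in auto)
  also have "\<dots> = (n * ?p * ln (2 * ?p / p \<sigma>) + n * ?q * ln (2 * ?q / p \<sigma>)
      + M.expectation (\<lambda>\<omega>. (u n \<omega>)\<^sup>2) / (n * ?p) + M.expectation (\<lambda>\<omega>. (v n \<omega>)\<^sup>2) / (n * ?q)
      - 2 * (n * ?p + n * ?q) + n * p \<sigma>) / n"
    by (simp add: expectation_count M.prob_space)
  also have "\<dots> \<le> (n * ?p * ln (2 * ?p / p \<sigma>) + n * ?q * ln (2 * ?q / p \<sigma>)
      + (1 + n * ?p) + (1 + n * ?q) - 2 * (n * ?p + n * ?q) + n * p \<sigma>) / n"
  proof -
    have "M.expectation (\<lambda>\<omega>. (count n \<omega> \<epsilon>)\<^sup>2) / (n * p \<epsilon>) \<le> 1 + n * p \<epsilon>" for \<epsilon>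
    proof -
      have np: "0 < n * p \<epsilon>" using n' f_pos by simp
      have "n * p \<epsilon> + (n * p \<epsilon>)\<^sup>2 = (1 + n * p \<epsilon>) * (n * p \<epsilon>)" by (simp add: power2_eq_square distrib_right)
      with expectation_count_square[of n \<epsilon>] show ?thesis using np by (simp add: divide_le_eq)
    qed
    from this[of "\<sigma> @ [False]"] this[of "\<sigma> @ [True]"] show ?thesis
      by (intro divide_right_mono add_mono diff_right_mono order_refl) auto
  qed
  also have "\<dots> = split_entropy f \<sigma> + 2 / n"
  proof -
    have *: "n * ?p * ln (2 * ?p / p \<sigma>) + n * ?q * ln (2 * ?q / p \<sigma>)
      + (1 + n * ?p) + (1 + n * ?q) - 2 * (n * ?p + n * ?q) + n * p \<sigma> = n * split_entropy f \<sigma> + 2"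
      by (simp add: split_entropy_eq p_split[symmetric, of \<sigma>]) (simp add: algebra_simps)
    show ?thesis unfolding * using n' by (simp add: add_divide_distrib)
  qed
  finally have 1: "M.expectation (\<lambda>\<omega>. log_split A (u n \<omega>) (v n \<omega>) / n) \<le> split_entropy f \<sigma> + 2 / n" .
  have "M.expectation (\<lambda>\<omega>. log_split A (u n \<omega>) (v n \<omega>) / n) \<le> M.expectation (\<lambda>\<omega>. n / (2 * A))"
    using integrable_log_split[OF n] log_split_count_bounds(3)[OF n] by (intro integral_mono) auto
  then have 2: "M.expectation (\<lambda>\<omega>. log_split A (u n \<omega>) (v n \<omega>) / n) \<le> n / (2 * A)"
    by (simp add: M.prob_space)
  have D: "0 \<le> split_entropy f \<sigma>" by (rule split_entropy_nonneg[OF f_integrable f_pos])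
  have s: "0 < sqrt A" "A = sqrt A * sqrt A" using A by auto
  show ?thesis
  \<comment> \<open>At n = 2 sqrt A both 2 / n and n / (2 A) equal 1 / sqrt A.\<close>
  proof (cases "n \<le> 2 * sqrt A")
    case True
    have "n / (2 * A) \<le> 2 * sqrt A / (2 * A)" using True A by (intro divide_right_mono) auto
    also have "\<dots> = 1 / sqrt A" using s by (simp add: field_simps)
    finally show ?thesis using 2 D by linarith
  next
    case False
    then have "2 / n \<le> 2 / (2 * sqrt A)" using s by (intro frac_le) auto
    then show ?thesis using 1 by simp
  qed
qed

text \<open>A dominating term need not be small. The split entropies are summable over the whole
  tree, so only 3 / sqrt A has to be weighed against the number of cells.\<close>

lemma node_mean_dominated:
  assumes n: "0 < n"
  shows "M.expectation (\<lambda>\<omega>. \<bar>node_mean a n \<sigma> \<omega> - split_entropy f \<sigma>\<bar>) \<le> 2 * split_entropy f \<sigma> + 3 / sqrt A"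
proof -
  have D: "0 \<le> split_entropy f \<sigma>" by (rule split_entropy_nonneg[OF f_integrable f_pos])
  have "M.expectation (\<lambda>\<omega>. \<bar>node_mean a n \<sigma> \<omega> - split_entropy f \<sigma>\<bar>)
      \<le> M.expectation (\<lambda>\<omega>. log_split A (u n \<omega>) (v n \<omega>) / n + (2 / A + split_entropy f \<sigma>))"
  proof (rule integral_mono)
    fix \<omega>
    show "\<bar>node_mean a n \<sigma> \<omega> - split_entropy f \<sigma>\<bar> \<le> log_split A (u n \<omega>) (v n \<omega>) / n + (2 / A + split_entropy f \<sigma>)"
      using node_mean_abs_le[OF n, of \<omega>] D by linarith
  qed (use integrable_node_mean[OF n] integrable_log_split[OF n] in auto)
  also have "\<dots> = M.expectation (\<lambda>\<omega>. log_split A (u n \<omega>) (v n \<omega>) / n) + (2 / A + split_entropy f \<sigma>)"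
    using integrable_log_split[OF n] by (subst Bochner_Integration.integral_add) (auto simp: M.prob_space)
  also have "\<dots> \<le> split_entropy f \<sigma> + 1 / sqrt A + (2 / A + split_entropy f \<sigma>)"
    using expectation_log_split_le[OF n] by simp
  also have "2 / A \<le> 2 / sqrt A"
  proof -
    have "1 \<le> sqrt A" using A4 by simp
    then have "sqrt A * 1 \<le> sqrt A * sqrt A" by (intro mult_left_mono) auto
    then show ?thesis using A4 by (intro divide_left_mono) auto
  qed
  finally show ?thesis by simp
qed

text \<open>Chebyshev's argument as one pointwise bound: if both frequencies are within
  \<open>d\<close> of their limits, continuity applies; otherwise the crude bound \<open>C\<close>
  is at most C / d^2 times the squared deviations, whose means are at most 1 / n.\<close>

lemma node_mean_limit:
  "(\<lambda>n. M.expectation (\<lambda>\<omega>. \<bar>node_mean a n \<sigma> \<omega> - split_entropy f \<sigma>\<bar>)) \<longlonglongrightarrow> 0"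
proof (rule LIMSEQ_I)
  fix e :: real assume e: "0 < e"
  let ?p = "p (\<sigma> @ [False])" and ?q = "p (\<sigma> @ [True])" and ?D = "split_entropy f \<sigma>"
  have D: "0 \<le> ?D" by (rule split_entropy_nonneg[OF f_integrable f_pos])
  obtain n0 d where d: "0 < d" and lim: "\<And>n u v. n0 \<le> n \<Longrightarrow> \<bar>u / real n - ?p\<bar> < d \<Longrightarrow> \<bar>v / real n - ?q\<bar> < d \<Longrightarrow>
    \<bar>log_split A u v / real n - (?p * ln (2 * ?p / (?p + ?q)) + ?q * ln (2 * ?q / (?p + ?q)))\<bar> < e / 2"
    using e by (rule_tac log_split_limit[OF f_pos[of "\<sigma> @ [False]"] f_pos[of "\<sigma> @ [True]"], of "e / 2"]) (simp, blast)
  define C where "C = ln 2 + 2 / A + ?D"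
  have C: "0 \<le> C" using D A4 by (simp add: C_def)
  define w where "w n \<epsilon> \<omega> = (count n \<omega> \<epsilon> / n - p \<epsilon>)\<^sup>2" for n \<epsilon> \<omega>
  have w: "0 \<le> w n \<epsilon> \<omega>" for n \<epsilon> \<omega> by (simp add: w_def)
  have wi: "integrable M (w n \<epsilon>)" for n \<epsilon>
    unfolding w_def power2_diff power_divide by simp
  have bound: "M.expectation (\<lambda>\<omega>. \<bar>node_mean a n \<sigma> \<omega> - ?D\<bar>) \<le> e / 2 + (4 + 2 * C / d\<^sup>2) / n" if n: "n0 \<le> n" "0 < n" for n
  proof -
    have "M.expectation (\<lambda>\<omega>. \<bar>node_mean a n \<sigma> \<omega> - ?D\<bar>)
      \<le> M.expectation (\<lambda>\<omega>. e / 2 + 4 / n + C / d\<^sup>2 * (w n (\<sigma> @ [False]) \<omega> + w n (\<sigma> @ [True]) \<omega>))"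
    proof (rule integral_mono)
      fix \<omega>
      let ?w = "w n (\<sigma> @ [False]) \<omega> + w n (\<sigma> @ [True]) \<omega>"
      show "\<bar>node_mean a n \<sigma> \<omega> - ?D\<bar> \<le> e / 2 + 4 / n + C / d\<^sup>2 * ?w"
      proof (cases "\<bar>u n \<omega> / n - ?p\<bar> < d \<and> \<bar>v n \<omega> / n - ?q\<bar> < d")
        case True
        with lim[of n "u n \<omega>" "v n \<omega>"] n have "\<bar>log_split A (u n \<omega>) (v n \<omega>) / n - ?D\<bar> < e / 2"
          by (simp add: split_entropy_eq p_split)
        moreover have "0 \<le> C / d\<^sup>2 * ?w" using C w by simp
        ultimately show ?thesis using node_mean_bounds(1,3)[OF n(2), of \<omega>] by linarith
      next
        case False
        have sq: "d\<^sup>2 \<le> r\<^sup>2" if "\<not> \<bar>r\<bar> < d" for r :: real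
          using that d by (metis abs_le_square_iff abs_of_pos linorder_not_less)
        from False have "d\<^sup>2 \<le> w n (\<sigma> @ [False]) \<omega> \<or> d\<^sup>2 \<le> w n (\<sigma> @ [True]) \<omega>"
          unfolding w_def using sq by blast
        then have "d\<^sup>2 \<le> ?w" using w[of n "\<sigma> @ [False]" \<omega>] w[of n "\<sigma> @ [True]" \<omega>] by linarith
        then have "C / d\<^sup>2 * d\<^sup>2 \<le> C / d\<^sup>2 * ?w" using C by (intro mult_left_mono) auto
        then have "C \<le> C / d\<^sup>2 * ?w" using d by simp
        moreover have "\<bar>node_mean a n \<sigma> \<omega> - ?D\<bar> \<le> C"
          using node_mean_abs_le_const[OF n(2), of \<omega>] D by (simp add: C_def)
        moreover have "0 \<le> e / 2 + 4 / n" using e by simp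
        ultimately show ?thesis by linarith
      qed
    qed (use integrable_node_mean[OF n(2)] wi in auto)
    also have "\<dots> = e / 2 + 4 / n + C / d\<^sup>2 * (M.expectation (w n (\<sigma> @ [False])) + M.expectation (w n (\<sigma> @ [True])))"
      using wi by (simp add: M.prob_space)
    also have "\<dots> \<le> e / 2 + 4 / n + C / d\<^sup>2 * (1 / n + 1 / n)"
      using count_frequency_variance[OF n(2)] C unfolding w_def
      by (intro add_left_mono mult_left_mono add_mono) auto
    also have "\<dots> = e / 2 + (4 + 2 * C / d\<^sup>2) / n" by (simp add: add_divide_distrib)
    finally show ?thesis .
  qed
  have "(\<lambda>n. (4 + 2 * C / d\<^sup>2) / real n) \<longlonglongrightarrow> 0" by (rule lim_const_over_n)
  from order_tendstoD(2)[OF this, of "e / 2"] e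
  obtain n1 where n1: "\<And>n. n1 \<le> n \<Longrightarrow> (4 + 2 * C / d\<^sup>2) / real n < e / 2" by (auto simp: eventually_sequentially)
  show "\<exists>no. \<forall>n\<ge>no. norm (M.expectation (\<lambda>\<omega>. \<bar>node_mean a n \<sigma> \<omega> - ?D\<bar>) - 0) < e"
  proof (intro exI[of _ "max 1 (max n0 n1)"] allI impI)
    fix n assume "max 1 (max n0 n1) \<le> n"
    then have n: "n0 \<le> n" "0 < n" "n1 \<le> n" by auto
    have "M.expectation (\<lambda>\<omega>. \<bar>node_mean a n \<sigma> \<omega> - ?D\<bar>) < e"
      using bound[OF n(1,2)] n1[OF n(3)] by linarith
    then show "norm (M.expectation (\<lambda>\<omega>. \<bar>node_mean a n \<sigma> \<omega> - ?D\<bar>) - 0) < e"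
      by simp
  qed
qed

end

end

section \<open>Consistency\<close>

context iid_sample
begin

section \<open>Summation over the levels\<close>

context
  fixes a :: "nat \<Rightarrow> real" and \<beta> :: real
  assumes a: "\<And>l. l \<ge> 1 \<Longrightarrow> a l = 2 powr (\<beta> * real l)" and \<beta>: "2 < \<beta>"
begin

lemma a_ge_4: "4 \<le> a (Suc l)"
  using four_le_two_powr[OF \<beta>, of l] a[of "Suc l"] by simp

definition level_error :: "nat \<Rightarrow> nat \<Rightarrow> 'w \<Rightarrow> real" where
  "level_error k n \<omega> = (\<Sum>\<sigma>\<in>words k. node_mean a n \<sigma> \<omega>) - (\<Sum>\<sigma>\<in>words k. split_entropy f \<sigma>)"

lemma level_error_measurable [measurable]: "level_error k n \<in> borel_measurable M"
  unfolding level_error_def[abs_def] by measurable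

lemma integrable_level_error: "0 < n \<Longrightarrow> integrable M (level_error k n)"
  unfolding level_error_def[abs_def]
  by (intro Bochner_Integration.integrable_diff Bochner_Integration.integrable_sum integrable_node_mean a_ge_4) auto

lemma expectation_level_error_le:
  assumes n: "0 < n"
  shows "M.expectation (\<lambda>\<omega>. \<bar>level_error k n \<omega>\<bar>) \<le> (\<Sum>\<sigma>\<in>words k. M.expectation (\<lambda>\<omega>. \<bar>node_mean a n \<sigma> \<omega> - split_entropy f \<sigma>\<bar>))"
proof -
  have int: "integrable M (\<lambda>\<omega>. \<bar>node_mean a n \<sigma> \<omega> - split_entropy f \<sigma>\<bar>)" for \<sigma>
    using integrable_node_mean[where a=a and \<sigma>=\<sigma>, OF a_ge_4 n] by simp
  have "M.expectation (\<lambda>\<omega>. \<bar>level_error k n \<omega>\<bar>) \<le> M.expectation (\<lambda>\<omega>. \<Sum>\<sigma>\<in>words k. \<bar>node_mean a n \<sigma> \<omega> - split_entropy f \<sigma>\<bar>)"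
  proof (rule integral_mono)
    fix \<omega>
    show "\<bar>level_error k n \<omega>\<bar> \<le> (\<Sum>\<sigma>\<in>words k. \<bar>node_mean a n \<sigma> \<omega> - split_entropy f \<sigma>\<bar>)"
      unfolding level_error_def sum_subtractf[symmetric] by (rule sum_abs)
  qed (use integrable_level_error[OF n] int in auto)
  then show ?thesis using int by (simp add: Bochner_Integration.integral_sum)
qed

text \<open>The exponent combines at most 2^(k + 1) cells with 1 / sqrt (a (k + 1)); it decays
  geometrically since \<beta> > 2.\<close>

definition level_bound :: "nat \<Rightarrow> real" where
  "level_bound k = 2 * (\<Sum>\<sigma>\<in>words k. split_entropy f \<sigma>) + 3 * 2 powr (- (\<beta> / 2 - 1) * real (Suc k))"

lemma level_error_dominated:
  assumes n: "0 < n"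
  shows "M.expectation (\<lambda>\<omega>. \<bar>level_error k n \<omega>\<bar>) \<le> level_bound k"
proof -
  have sqrt_a: "sqrt (a (Suc k)) = 2 powr (\<beta> / 2 * real (Suc k))"
    using powr_half_sqrt_powr[of 2 "\<beta> * real (Suc k)"] a[of "Suc k"] by simp
  have "M.expectation (\<lambda>\<omega>. \<bar>node_mean a n \<sigma> \<omega> - split_entropy f \<sigma>\<bar>) \<le> 2 * split_entropy f \<sigma> + 3 / sqrt (a (Suc k))"
    if "\<sigma> \<in> words k" for \<sigma>
    using node_mean_dominated[where a=a and \<sigma>=\<sigma>, OF a_ge_4 n] that by simp
  then have "M.expectation (\<lambda>\<omega>. \<bar>level_error k n \<omega>\<bar>) \<le> (\<Sum>\<sigma>\<in>words k. 2 * split_entropy f \<sigma> + 3 / sqrt (a (Suc k)))"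
    by (intro order_trans[OF expectation_level_error_le[OF n]] sum_mono)
  also have "\<dots> = 2 * (\<Sum>\<sigma>\<in>words k. split_entropy f \<sigma>) + 2 ^ k * (3 / sqrt (a (Suc k)))"
    by (simp add: sum.distrib sum_distrib_left card_words)
  also have "2 ^ k * (3 / sqrt (a (Suc k))) \<le> 3 * 2 powr (- (\<beta> / 2 - 1) * real (Suc k))"
  proof -
    \<comment> \<open>Rounding the number of cells up aligns its exponent with that of
      \<open>a (Suc k)\<close>.\<close>
    have "(2::real) ^ k \<le> 2 powr real (Suc k)" by (simp add: powr_realpow[symmetric])
    then have "2 ^ k * (3 / sqrt (a (Suc k))) \<le> 2 powr real (Suc k) * (3 / sqrt (a (Suc k)))"
      using a_ge_4[of k] by (intro mult_right_mono) auto
    also have "\<dots> = 3 * (2 powr real (Suc k) / 2 powr (\<beta> / 2 * real (Suc k)))"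
      by (simp add: sqrt_a)
    also have "2 powr real (Suc k) / 2 powr (\<beta> / 2 * real (Suc k)) = 2 powr (- (\<beta> / 2 - 1) * real (Suc k))"
      by (subst powr_diff[symmetric]) (simp add: algebra_simps)
    finally show ?thesis .
  qed
  finally show ?thesis by (simp add: level_bound_def)
qed

lemma level_error_limit: "(\<lambda>n. M.expectation (\<lambda>\<omega>. \<bar>level_error k n \<omega>\<bar>)) \<longlonglongrightarrow> 0"
proof (rule tendsto_sandwich[OF _ _ tendsto_const])
  show "(\<lambda>n. \<Sum>\<sigma>\<in>words k. M.expectation (\<lambda>\<omega>. \<bar>node_mean a n \<sigma> \<omega> - split_entropy f \<sigma>\<bar>)) \<longlonglongrightarrow> 0"
    by (intro tendsto_null_sum node_mean_limit a_ge_4)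
  show "\<forall>\<^sub>F n in sequentially. M.expectation (\<lambda>\<omega>. \<bar>level_error k n \<omega>\<bar>)
      \<le> (\<Sum>\<sigma>\<in>words k. M.expectation (\<lambda>\<omega>. \<bar>node_mean a n \<sigma> \<omega> - split_entropy f \<sigma>\<bar>))"
    using eventually_gt_at_top[of 0] by eventually_elim (rule expectation_level_error_le)
qed auto

text \<open>The deviation of the series is at most the sum of the absolute level errors, whose mean
  tends to 0 by Tannery's theorem; Markov's inequality concludes.\<close>

theorem level_sums_converge_in_prob:
  assumes D: "(\<lambda>k. \<Sum>\<sigma>\<in>words k. split_entropy f \<sigma>) sums h"
    and S: "\<And>n \<omega>. \<omega> \<in> space M \<Longrightarrow> (\<lambda>k. \<Sum>\<sigma>\<in>words k. node_mean a n \<sigma> \<omega>) sums S n \<omega>"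
  shows "converges_in_prob M (\<lambda>n \<omega>. \<bar>S n \<omega> - h\<bar>) 0"
proof -
  have Sm [measurable]: "S n \<in> borel_measurable M" for n
  proof -
    have "(\<lambda>\<omega>. \<Sum>k. \<Sum>\<sigma>\<in>words k. node_mean a n \<sigma> \<omega>) \<in> borel_measurable M" by measurable
    then show ?thesis
      by (rule measurable_cong[THEN iffD1, rotated]) (use S in \<open>auto simp: sums_iff\<close>)
  qed
  define e where "e k n = M.expectation (\<lambda>\<omega>. \<bar>level_error k n \<omega>\<bar>)" for k n
  have e0: "0 \<le> e k n" for k n by (simp add: e_def)
  have bound: "summable level_bound"
    unfolding level_bound_def using D \<beta>
    by (intro summable_add summable_mult summable_two_powr_Suc) (auto simp: sums_iff)
  have lim: "(\<lambda>n. \<Sum>k. e k n) \<longlonglongrightarrow> 0"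
  proof -
    \<comment> \<open>The domination holds for all levels but only for n > 0, hence the product
      filter.\<close>
    have "\<forall>\<^sub>F (k, n) in at_top \<times>\<^sub>F sequentially. norm (e k n) \<le> level_bound k"
    proof -
      have "\<forall>\<^sub>F z in at_top \<times>\<^sub>F sequentially. True \<and> 0 < snd (z :: nat \<times> nat)"
        by (rule eventually_prodI[of "\<lambda>_. True"]) (auto simp: eventually_gt_at_top)
      then show ?thesis
        by eventually_elim (auto simp: e_def level_error_dominated)
    qed
    from tannerys_theorem[OF level_error_limit[folded e_def] this bound]
    show ?thesis by simp
  qed
  have markov: "M.prob {\<omega> \<in> space M. \<delta> < \<bar>S n \<omega> - h\<bar>} \<le> (\<Sum>k. e k n) / \<delta>" if \<delta>: "0 < \<delta>" and n: "0 < n" for \<delta> n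
  proof -
    have int: "integrable M (\<lambda>\<omega>. \<bar>level_error k n \<omega>\<bar>)" for k using integrable_level_error[OF n] by simp
    have se: "summable (\<lambda>k. e k n)"
      using level_error_dominated[OF n] e0
      by (intro summable_comparison_test'[OF bound, of 0]) (auto simp: e_def)
    have ae: "AE \<omega> in M. summable (\<lambda>k. \<bar>level_error k n \<omega>\<bar>)"
      using AE_summable_of_integrals[OF integrable_level_error[OF n]] se by (simp add: e_def)
    have i: "integrable M (\<lambda>\<omega>. \<Sum>k. \<bar>level_error k n \<omega>\<bar>)"
      and eq: "M.expectation (\<lambda>\<omega>. \<Sum>k. \<bar>level_error k n \<omega>\<bar>) = (\<Sum>k. e k n)"
      using integrable_suminf[OF int] integral_suminf[OF int] ae se by (simp_all add: e_def)
    have "M.prob {\<omega> \<in> space M. \<delta> < \<bar>S n \<omega> - h\<bar>} \<le> M.prob {\<omega> \<in> space M. \<delta> \<le> (\<Sum>k. \<bar>level_error k n \<omega>\<bar>)}"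
    proof (rule M.finite_measure_mono_AE)
      show "AE \<omega> in M. \<omega> \<in> {\<omega> \<in> space M. \<delta> < \<bar>S n \<omega> - h\<bar>} \<longrightarrow> \<omega> \<in> {\<omega> \<in> space M. \<delta> \<le> (\<Sum>k. \<bar>level_error k n \<omega>\<bar>)}"
        using ae AE_space
      proof eventually_elim
        case (elim \<omega>)
        have "(\<lambda>k. level_error k n \<omega>) sums (S n \<omega> - h)"
          unfolding level_error_def by (intro sums_diff S D elim)
        then have "\<bar>S n \<omega> - h\<bar> \<le> (\<Sum>k. \<bar>level_error k n \<omega>\<bar>)"
          using summable_rabs[OF elim(1)] by (simp add: sums_iff)
        then show ?case by auto
      qed
    qed measurable
    also have "\<dots> \<le> M.expectation (\<lambda>\<omega>. \<Sum>k. \<bar>level_error k n \<omega>\<bar>) / \<delta>"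
    proof (rule integral_Markov_inequality_measure[OF i _ _ \<delta>])
      show "AE \<omega> in M. 0 \<le> (\<Sum>k. \<bar>level_error k n \<omega>\<bar>)"
        using ae by eventually_elim (auto intro: suminf_nonneg)
      show "space M \<in> sets M" by simp
    qed
    finally show ?thesis by (simp add: eq)
  qed
  show ?thesis
    unfolding converges_in_prob_def
  proof (intro conjI allI impI)
    fix \<delta> :: real assume \<delta>: "0 < \<delta>"
    show "(\<lambda>n. M.prob {\<omega> \<in> space M. \<delta> < \<bar>\<bar>S n \<omega> - h\<bar> - 0\<bar>}) \<longlonglongrightarrow> 0"
    proof (rule tendsto_sandwich[OF _ _ tendsto_const])
      show "(\<lambda>n. (\<Sum>k. e k n) / \<delta>) \<longlonglongrightarrow> 0"
        using tendsto_divide[OF lim tendsto_const[of \<delta>]] \<delta> by simp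
      show "\<forall>\<^sub>F n in sequentially. M.prob {\<omega> \<in> space M. \<delta> < \<bar>\<bar>S n \<omega> - h\<bar> - 0\<bar>} \<le> (\<Sum>k. e k n) / \<delta>"
        using eventually_gt_at_top[of 0] by eventually_elim (use markov[OF \<delta>] in simp)
    qed auto
  qed measurable
qed

end

end

lemma (in dyadic_tree) cell_integral_eq: "cell_integral f \<epsilon> = (LINT t:B \<epsilon>|lborel. f t)"
  unfolding cell_integral_def set_lebesgue_integral_def
  using cell_subset[of \<epsilon>]
  by (subst integral_restrict_space) (auto intro!: Bochner_Integration.integral_cong simp: indicator_def)

text \<open>If a child of a cell of positive mass were null, its sibling would carry the whole mass
  with ratio 1, against the bound on the supremum.\<close>

lemma (in dyadic_tree) cell_integral_pos:
  assumes f: "integrable \<mu> f" and nn: "\<And>x. x \<in> \<X> \<Longrightarrow> 0 \<le> f x" and one: "cell_integral f [] = 1"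
    and sup: "(SUP \<epsilon>\<in>{\<epsilon>. \<epsilon> \<noteq> []}. cell_integral f \<epsilon> / cell_integral f (butlast \<epsilon>)) < 1"
  shows "0 < cell_integral f \<epsilon>"
proof -
  have p0: "0 \<le> cell_integral f \<epsilon>" for \<epsilon>
    unfolding cell_integral_def by (rule integral_nonneg_AE) (auto intro!: AE_I2 mult_nonneg_nonneg nn)
  have split: "cell_integral f (\<sigma> @ [b]) + cell_integral f (\<sigma> @ [\<not> b]) = cell_integral f \<sigma>" for \<sigma> b
    using cell_integral_split[OF f, of \<sigma>] by (cases b) auto
  have le1: "cell_integral f \<epsilon> / cell_integral f (butlast \<epsilon>) \<le> 1" if ne: "\<epsilon> \<noteq> []" for \<epsilon>
  proof -
    obtain \<sigma> b where \<epsilon>: "\<epsilon> = \<sigma> @ [b]" using ne by (cases \<epsilon> rule: rev_cases) auto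
    have "cell_integral f (\<sigma> @ [b]) \<le> cell_integral f \<sigma>"
      using split[of \<sigma> b] p0[of "\<sigma> @ [\<not> b]"] by linarith
    then show ?thesis using p0[of \<sigma>] by (auto simp: \<epsilon> divide_le_eq_1)
  qed
  have lt1: "cell_integral f \<epsilon> / cell_integral f (butlast \<epsilon>) < 1" if "\<epsilon> \<noteq> []" for \<epsilon>
  proof -
    \<comment> \<open>A real supremum is known to dominate its family only if that family is
      bounded. For a null parent the ratio is 0 by convention, so 1 is a bound throughout.\<close>
    have "bdd_above ((\<lambda>\<epsilon>. cell_integral f \<epsilon> / cell_integral f (butlast \<epsilon>)) ` {\<epsilon>. \<epsilon> \<noteq> []})"
      by (rule bdd_aboveI2[of _ _ 1]) (use le1 in auto)
    from cSUP_upper[OF _ this, of \<epsilon>] that sup show ?thesis by simp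
  qed
  show ?thesis
  proof (induction \<epsilon> rule: rev_induct)
    case (snoc b \<sigma>)
    have "cell_integral f (\<sigma> @ [b]) \<noteq> 0"
    proof
      assume "cell_integral f (\<sigma> @ [b]) = 0"
      then have "cell_integral f (\<sigma> @ [\<not> b]) = cell_integral f \<sigma>" using split[of \<sigma> b] by simp
      with lt1[of "\<sigma> @ [\<not> b]"] snoc show False by simp
    qed
    with p0[of "\<sigma> @ [b]"] show ?case by simp
  qed (simp add: one[unfolded cell_Nil])
qed

theorem theorem2:
  fixes \<X> :: "'a::euclidean_space set"
    and B :: "bool list \<Rightarrow> 'a set"
    and a :: "nat \<Rightarrow> real"
    and \<beta> :: real
    and f0 :: "'a \<Rightarrow> real"
    and M :: "'w measure"
    and X :: "nat \<Rightarrow> 'w \<Rightarrow> 'a"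
    and prior :: "'a measure measure"
    and post :: "nat \<Rightarrow> (nat \<Rightarrow> 'a) \<Rightarrow> 'a measure measure"
  assumes "compact \<X>"
    and "partition_tree \<X> B"
    and "\<And>\<epsilon>. measure lborel (B \<epsilon>) = (1 / 2) ^ length \<epsilon>"
    and "\<And>l. 0 < a l"
    and "summable (\<lambda>l. real (Suc l) / a (Suc l))"
    and "polya_tree \<X> B (\<lambda>\<epsilon>. a (length \<epsilon>)) prior"
    and "\<And>n x. (\<And>i. i < n \<Longrightarrow> x i \<in> \<X>) \<Longrightarrow>
           polya_tree \<X> B (posterior_param B (\<lambda>\<epsilon>. a (length \<epsilon>)) n x) (post n x)"
    and "prob_density_on \<X> f0"
    and "finite_entropy \<X> f0"
    and "(SUP \<epsilon>\<in>{\<epsilon>. \<epsilon> \<noteq> []}.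
            (LINT t:B \<epsilon>|lborel. f0 t) / (LINT t:B (butlast \<epsilon>)|lborel. f0 t)) < 1"
    and "prob_space M"
    and "prob_space.indep_vars M (\<lambda>_. restrict_space lborel \<X>) X UNIV"
    and "\<And>i. distributed M (restrict_space lborel \<X>) (X i) (\<lambda>t. ennreal (f0 t))"
    and "\<beta> > 2"
    and "\<And>l. l \<ge> 1 \<Longrightarrow> a l = 2 powr (\<beta> * real l)"
  shows "(\<forall>n x. (\<forall>i<n. x i \<in> \<X>) \<longrightarrow>
            ((\<lambda>\<epsilon>. sample_count B n x \<epsilon> / real n * (LINT P|post n x. ln (2 * Y B P \<epsilon>)))
               has_sum - entropy_estimator B (post n x) n x) {\<epsilon>. length \<epsilon> \<ge> 1}) \<and>
         converges_in_prob M
           (\<lambda>n \<omega>. \<bar>entropy_estimator B (post n (\<lambda>i. X i \<omega>)) n (\<lambda>i. X i \<omega>) - diff_entropy \<X> f0\<bar>) 0"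
proof
  interpret tree: dyadic_tree \<X> B
    by unfold_locales (fact assms(2), fact assms(3))
  note expand = tree.entropy_estimator_expansion[OF assms(4) assms(15) assms(14) _ assms(7)]
  show "\<forall>n x. (\<forall>i<n. x i \<in> \<X>) \<longrightarrow>
            ((\<lambda>\<epsilon>. sample_count B n x \<epsilon> / real n * (LINT P|post n x. ln (2 * Y B P \<epsilon>)))
               has_sum - entropy_estimator B (post n x) n x) {\<epsilon>. length \<epsilon> \<ge> 1}"
    by (intro allI impI expand(1)) auto
  have nn: "0 \<le> f0 x" if "x \<in> \<X>" for x
    using assms(8) that by (simp add: prob_density_on_def)
  have int: "integrable (restrict_space lborel \<X>) f0"
    using assms(8) by (simp add: prob_density_on_def integrable_restrict_space set_integrable_def)
  have one: "tree.cell_integral f0 [] = 1"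
    using assms(8) by (simp only: tree.cell_integral_eq tree.cell_Nil prob_density_on_def)
  have fin: "integrable (restrict_space lborel \<X>) (\<lambda>x. f0 x * ln (f0 x))"
    using assms(9) by (simp add: finite_entropy_def integrable_restrict_space set_integrable_def)
  have pos: "0 < tree.cell_integral f0 \<epsilon>" for \<epsilon>
    by (rule tree.cell_integral_pos[OF int nn one]) (use assms(10) in \<open>simp_all only: tree.cell_integral_eq\<close>)
  interpret M: prob_space M by fact
  interpret iid_sample \<X> B M X f0
    by unfold_locales (rule assms(12) assms(13) int one pos | (rule nn, assumption))+
  have D: "(\<lambda>k. \<Sum>\<sigma>\<in>words k. tree.split_entropy f0 \<sigma>) sums - diff_entropy \<X> f0"
    using tree.split_entropy_sums[OF int pos one nn fin]
    by (simp add: diff_entropy_def set_lebesgue_integral_def integral_restrict_space)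
  \<comment> \<open>Each \<open>X i\<close> maps all of \<open>space M\<close> into \<X>, so the
    expansion holds at every outcome.\<close>
  have S: "(\<lambda>k. \<Sum>\<sigma>\<in>words k. node_mean a n \<sigma> \<omega>) sums - entropy_estimator B (post n (\<lambda>i. X i \<omega>)) n (\<lambda>i. X i \<omega>)"
    if "\<omega> \<in> space M" for n \<omega>
    unfolding node_mean_def by (intro expand(2) Z_space that)
  have "converges_in_prob M
     (\<lambda>n \<omega>. \<bar>- entropy_estimator B (post n (\<lambda>i. X i \<omega>)) n (\<lambda>i. X i \<omega>) - - diff_entropy \<X> f0\<bar>) 0"
    by (rule level_sums_converge_in_prob[OF assms(15,14) D S])
  then show "converges_in_prob M
     (\<lambda>n \<omega>. \<bar>entropy_estimator B (post n (\<lambda>i. X i \<omega>)) n (\<lambda>i. X i \<omega>) - diff_entropy \<X> f0\<bar>) 0"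
    by (simp add: abs_minus_commute)
qed

end
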